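(* There exists a universal constant $C>0$ such that the following holds. Let $k,d,n$ be positive integers, $1\le r_w\le\min\{d,k\}$, $B_w,B_x>0$, and let $$\mathcal{W}=\{W\in\mathbb{R}^{k\times d}:\ \|W\|_{2\to2}\le B_w,\ \operatorname{rank}(W)\le r_w\},\qquad \mathcal{F}_*^{(2\to2)}=\{f_W:x\mapsto Wx:\ W\in\mathcal{W}\}.$$ Suppose the inputs $x_1,\dots,x_n\in\mathbb{R}^d$ satisfy $\|x_i\|_2\le B_x$ for $i=1,\dots,n$. Then, for every $0<\varepsilon\le B_xB_w$, $$\log\mathcal{N}_\infty\left(\mathcal{F}_*^{(2\to2)},\varepsilon,n,\|\cdot\|_2\right)\le r_w(d+k-r_w)\log\left(\frac{CB_xB_w}{\varepsilon}\right),$$ where $C$ is independent of $d,k,r_w,B_x,B_w,\varepsilon$ and $n$.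
   Context: $\|W\|_{2\to2}=\sup_{x\neq0}\|Wx\|_2/\|x\|_2$ is the operator norm. Covering numbers: for a class $\mathcal{F}$ of functions $\mathbb{R}^d\to\mathbb{R}^k$, $\varepsilon>0$ and points $x_1,\dots,x_n$, $\mathcal{N}_\infty(\mathcal{F},\varepsilon,\{x_i\},\|\cdot\|_2)$ is the smallest $m$ for which there exist functions $f_1,\dots,f_m:\mathbb{R}^d\to\mathbb{R}^k$ such that for every $f\in\mathcal{F}$, $\min_{j\in[m]}\max_{i\in[n]}\|f(x_i)-f_j(x_i)\|_2\le\varepsilon$. The quantity $\mathcal{N}_\infty(\mathcal{F},\varepsilon,n,\|\cdot\|_2)$ is the supremum of $\mathcal{N}_\infty(\mathcal{F},\varepsilon,\{x_i\},\|\cdot\|_2)$ over all samples $x_1,\dots,x_n$ of size $n$ satisfying the stated norm constraint on the inputs (here $\|x_i\|_2\le B_x$). *)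

theory Defs
  imports
    "HOL-Analysis.L2_Norm"
    "HOL-Library.Extended_Nat"
    "HOL-Library.FuncSet"
    "Jordan_Normal_Form.DL_Rank"
begin

text \<open>
  The constant of the theorem is uniform in the dimensions, so vectors and matrices are taken
  with explicit carriers \<open>carrier_vec d\<close> and \<open>carrier_mat k d\<close> rather than with the dimension
  in the type.
\<close>

definition vec_norm2 :: "real vec \<Rightarrow> real" where
  "vec_norm2 v = L2_set (vec_index v) {..<dim_vec v}"

definition mat_opnorm :: "real mat \<Rightarrow> real" where
  "mat_opnorm W =
     (SUP x \<in> {x \<in> carrier_vec (dim_col W). x \<noteq> 0\<^sub>v (dim_col W)}.
        vec_norm2 (W *\<^sub>v x) / vec_norm2 x)"

text \<open>
  \<open>Sup\<close> on the reals is meaningful only for nonempty sets bounded above. Nonemptiness is clear if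
  \<open>dim_col W > 0\<close>; boundedness is the following lemma.
\<close>

lemma bdd_above_mat_opnorm:
  "bdd_above ((\<lambda>x. vec_norm2 (W *\<^sub>v x) / vec_norm2 x) `
     {x \<in> carrier_vec (dim_col W). x \<noteq> 0\<^sub>v (dim_col W)})"
proof (rule bdd_aboveI2)
  fix x :: "real vec" assume "x \<in> {x \<in> carrier_vec (dim_col W). x \<noteq> 0\<^sub>v (dim_col W)}"
  then have x: "dim_vec x = dim_col W" by auto
  let ?B = "\<Sum>i<dim_row W. \<Sum>j<dim_col W. \<bar>W $$ (i, j)\<bar>"
  have nonneg: "0 \<le> vec_norm2 x" unfolding vec_norm2_def by (rule L2_set_nonneg)
  have comp: "\<bar>vec_index x j\<bar> \<le> vec_norm2 x" if "j < dim_col W" for j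
  proof -
    have "\<bar>vec_index x j\<bar> \<le> L2_set (\<lambda>j. \<bar>vec_index x j\<bar>) {..<dim_vec x}"
      by (rule member_le_L2_set) (use that x in auto)
    then show ?thesis by (simp add: vec_norm2_def L2_set_def)
  qed
  have "vec_norm2 (W *\<^sub>v x) \<le> (\<Sum>i<dim_row W. \<bar>vec_index (W *\<^sub>v x) i\<bar>)"
    using L2_set_le_sum_abs[of "vec_index (W *\<^sub>v x)" "{..<dim_row W}"] by (simp add: vec_norm2_def)
  also have "\<dots> \<le> (\<Sum>i<dim_row W. \<Sum>j<dim_col W. \<bar>W $$ (i, j)\<bar> * vec_norm2 x)"
  proof (rule sum_mono)
    fix i assume "i \<in> {..<dim_row W}"
    then have "\<bar>vec_index (W *\<^sub>v x) i\<bar> = \<bar>\<Sum>j<dim_col W. W $$ (i, j) * vec_index x j\<bar>"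
      using x by (simp add: scalar_prod_def atLeast0LessThan)
    also have "\<dots> \<le> (\<Sum>j<dim_col W. \<bar>W $$ (i, j) * vec_index x j\<bar>)" by (rule sum_abs)
    also have "\<dots> \<le> (\<Sum>j<dim_col W. \<bar>W $$ (i, j)\<bar> * vec_norm2 x)"
      by (rule sum_mono) (auto simp: abs_mult intro!: mult_left_mono comp)
    finally show "\<bar>vec_index (W *\<^sub>v x) i\<bar> \<le> \<dots>" .
  qed
  also have "\<dots> = ?B * vec_norm2 x" by (simp add: sum_distrib_right)
  finally have "vec_norm2 (W *\<^sub>v x) \<le> ?B * vec_norm2 x" .
  moreover have "0 \<le> ?B" by (intro sum_nonneg) auto
  ultimately show "vec_norm2 (W *\<^sub>v x) / vec_norm2 x \<le> ?B"
    using nonneg by (cases "vec_norm2 x = 0") (auto simp: divide_le_eq)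
qed

definition low_rank_mats :: "nat \<Rightarrow> nat \<Rightarrow> nat \<Rightarrow> real \<Rightarrow> real mat set" where
  "low_rank_mats k d r B =
     {W \<in> carrier_mat k d. mat_opnorm W \<le> B \<and> vec_space.rank k W \<le> r}"

definition linear_class :: "nat \<Rightarrow> nat \<Rightarrow> nat \<Rightarrow> real \<Rightarrow> (real vec \<Rightarrow> real vec) set" where
  "linear_class k d r B = (\<lambda>W x. W *\<^sub>v x) ` low_rank_mats k d r B"

text \<open>
  Covering numbers take values in \<open>enat\<close>, with value \<open>\<infinity>\<close> if there is no finite cover. The centres
  \<open>g 1, \<dots>, g m\<close> are arbitrary functions from \<open>d\<close>- to \<open>k\<close>-dimensional space, not necessarily
  members of the class.
\<close>

definition covering_number ::
  "nat \<Rightarrow> nat \<Rightarrow> (real vec \<Rightarrow> real vec) set \<Rightarrow> real \<Rightarrow> nat \<Rightarrow> (nat \<Rightarrow> real vec) \<Rightarrow> enat" where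
  "covering_number k d F \<epsilon> n x =
     Inf {enat m | m. \<exists>g. (\<forall>j\<in>{1..m}. g j \<in> carrier_vec d \<rightarrow> carrier_vec k) \<and>
       (\<forall>f\<in>F. \<exists>j\<in>{1..m}. \<forall>i\<in>{1..n}. vec_norm2 (f (x i) - g j (x i)) \<le> \<epsilon>)}"

definition uniform_covering_number ::
  "nat \<Rightarrow> nat \<Rightarrow> (real vec \<Rightarrow> real vec) set \<Rightarrow> real \<Rightarrow> nat \<Rightarrow> real \<Rightarrow> enat" where
  "uniform_covering_number k d F \<epsilon> n B =
     (SUP x \<in> {x. \<forall>i\<in>{1..n}. x i \<in> carrier_vec d \<and> vec_norm2 (x i) \<le> B}.
        covering_number k d F \<epsilon> n x)"

end

theory Submission
  imports Defs
begin

text \<open>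
  The manifold of \<open>k \<times> d\<close> matrices of rank \<open>r\<close> has dimension \<open>r * (d + k - r)\<close>, and it is covered
  by few charts. Fix an orthonormal \<open>k\<close>-frame, split into \<open>U\<^sub>0\<close> (the first \<open>r\<close> columns) and \<open>V\<^sub>0\<close>. If
  the column space of \<open>W\<close> lies in the range of a frame \<open>U\<close> near \<open>U\<^sub>0\<close>, it is the graph of a map of
  norm at most 1, that is, \<open>W = U\<^sub>0 A + V\<^sub>0 T A\<close> with \<open>A = U\<^sub>0\<^sup>T W\<close> of size \<open>r \<times> d\<close> and a
  contraction \<open>T\<close> of size \<open>(k - r) \<times> r\<close>. Nets for \<open>A\<close> and \<open>T\<close> in operator norm give the factor
  \<open>(9 / \<delta>) ^ (r * (d + k - r))\<close>, and the number of charts is only \<open>36 ^ (2 * r * (k - r))\<close>.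

  The nets come from a volumetric bound, in which the volume of a ball \<open>K\<close> is replaced by the number
  of points of a fine lattice in it: reduction modulo \<open>q\<close> shows that \<open>q K\<close> has at most \<open>q ^ N\<close> times
  as many lattice points as \<open>2 K\<close>.
\<close>

section \<open>Coverings of unit balls by lattice point counting\<close>

text \<open>\<open>bnd x a\<close> stands for \<open>\<parallel>x\<parallel> \<le> a\<close> for some norm on \<open>\<real>\<^sup>I\<close>, so that no value of the norm has to be defined.\<close>

locale bounding =
  fixes I :: "'i set" and bnd :: "('i \<Rightarrow> real) \<Rightarrow> real \<Rightarrow> bool" and L :: real
  assumes finite_index: "finite I"
    and bnd_diff: "\<And>x y a b. bnd x a \<Longrightarrow> bnd y b \<Longrightarrow> bnd (\<lambda>i. x i - y i) (a + b)"
    and bnd_scale: "\<And>x a s. bnd x a \<Longrightarrow> 0 \<le> s \<Longrightarrow> bnd (\<lambda>i. s * x i) (s * a)"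
    and bnd_mono: "\<And>x a b. bnd x a \<Longrightarrow> a \<le> b \<Longrightarrow> bnd x b"
    and bnd_coord: "\<And>x a i. bnd x a \<Longrightarrow> i \<in> I \<Longrightarrow> \<bar>x i\<bar> \<le> a"
    and coords_bnd: "\<And>x t. (\<And>i. i \<in> I \<Longrightarrow> \<bar>x i\<bar> \<le> t) \<Longrightarrow> 0 \<le> t \<Longrightarrow> bnd x (L * t)"
    and L_nonneg: "0 \<le> L"
begin

text \<open>Vanishing outside \<open>I\<close> makes such a function determined by its coordinates
  in \<open>I\<close>, so that the set is finite and the division by \<open>q\<close> below is exact
  in every coordinate.\<close>

definition lattice_points :: "real \<Rightarrow> ('i \<Rightarrow> int) set" where
  "lattice_points c = {z. (\<forall>i. i \<notin> I \<longrightarrow> z i = 0) \<and> bnd (\<lambda>i. of_int (z i)) c}"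

lemma bnd_zero: "0 \<le> a \<Longrightarrow> bnd (\<lambda>i. 0) a"
  using coords_bnd[of "\<lambda>i. 0" 0] bnd_mono by fastforce

lemma bnd_commute: "bnd (\<lambda>i. x i - y i) a \<Longrightarrow> bnd (\<lambda>i. y i - x i) a"
  using bnd_diff[OF bnd_zero[of 0], of "\<lambda>i. x i - y i" a] by simp

lemma bnd_add:
  assumes "bnd x a" "bnd y b"
  shows "bnd (\<lambda>i. x i + y i) (a + b)"
  using bnd_diff[OF assms(1) bnd_diff[OF bnd_zero[of 0] assms(2)]] by simp

lemma finite_lattice_points: "finite (lattice_points c)"
proof -
  have "lattice_points c \<subseteq> {z. (\<forall>i\<in>I. z i \<in> {-\<lfloor>c\<rfloor>..\<lfloor>c\<rfloor>}) \<and> (\<forall>i. i \<notin> I \<longrightarrow> z i = 0)}"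
  proof (intro subsetI CollectI conjI ballI)
    fix z i assume z: "z \<in> lattice_points c" and "i \<in> I"
    then have "\<bar>real_of_int (z i)\<bar> \<le> c" using bnd_coord unfolding lattice_points_def by blast
    then show "z i \<in> {-\<lfloor>c\<rfloor>..\<lfloor>c\<rfloor>}" unfolding abs_le_iff atLeastAtMost_iff
      by (metis le_floor_iff minus_le_iff of_int_minus)
  qed (auto simp: lattice_points_def)
  then show ?thesis
    using finite_set_of_finite_funs[OF finite_index, of "{-\<lfloor>c\<rfloor>..\<lfloor>c\<rfloor>}" 0]
    by (elim finite_subset) (simp add: Ball_def all_conj_distrib)
qed

lemma zero_lattice_point: "0 \<le> c \<Longrightarrow> (\<lambda>i. 0) \<in> lattice_points c"
  using bnd_zero by (simp add: lattice_points_def)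

text \<open>Points of \<open>lattice_points (q * s)\<close> in a common residue class modulo \<open>q\<close> differ by \<open>q\<close>
  times a point of \<open>lattice_points (2 * s)\<close>, and there are \<open>q ^ card I\<close> residue classes.\<close>

lemma card_lattice_points_mult:
  fixes q :: nat and s :: real
  assumes q: "q > 0"
  shows "card (lattice_points (q * s)) \<le> q ^ card I * card (lattice_points (2 * s))"
proof -
  let ?G = "lattice_points (q * s)"
  define res where "res z = restrict (\<lambda>i. z i mod int q) I" for z :: "'i \<Rightarrow> int"
  \<comment> \<open>The representative is taken from \<open>?G\<close> itself, so its difference
    from a point of the same class has norm at most \<open>2 * (q * s)\<close>. Class and quotient
    together recover the point.\<close>
  define rep where "rep c = (SOME z. z \<in> ?G \<and> res z = c)" for c
  define f where "f z = (res z, \<lambda>i. (z i - rep (res z) i) div int q)" for z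
  have rep: "rep (res z) \<in> ?G \<and> res (rep (res z)) = res z" if "z \<in> ?G" for z
    unfolding rep_def by (rule someI[of _ z]) (use that in auto)
  have eq: "int q * ((z i - rep (res z) i) div int q) = z i - rep (res z) i" if "z \<in> ?G" for z i
  proof (cases "i \<in> I")
    case True
    have "z i mod int q = rep (res z) i mod int q"
      using rep[OF that] True by (metis res_def restrict_apply')
    then show ?thesis by (simp add: mod_eq_dvd_iff)
  next
    case False
    then show ?thesis using rep[OF that] that by (auto simp: lattice_points_def)
  qed
  have inj: "inj_on f ?G"
  proof (rule inj_onI, rule ext)
    fix z w i assume *: "z \<in> ?G" "w \<in> ?G" "f z = f w"
    then have "res z = res w"
      "(z i - rep (res z) i) div int q = (w i - rep (res w) i) div int q"
      by (auto simp: f_def dest: fun_cong)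
    then have "z i - rep (res z) i = w i - rep (res z) i" using eq *(1,2) by metis
    then show "z i = w i" by simp
  qed
  have sub: "f ` ?G \<subseteq> (I \<rightarrow>\<^sub>E {0..<int q}) \<times> lattice_points (2 * s)"
  proof (rule image_subsetI)
    fix z assume z: "z \<in> ?G"
    have "res z \<in> I \<rightarrow>\<^sub>E {0..<int q}" using q by (auto simp: res_def)
    moreover have "(\<lambda>i. (z i - rep (res z) i) div int q) \<in> lattice_points (2 * s)"
    proof -
      have "bnd (\<lambda>i. inverse (real q) * (real_of_int (z i) - real_of_int (rep (res z) i)))
              (inverse (real q) * (q * s + q * s))"
        using z rep[OF z] by (intro bnd_scale bnd_diff) (auto simp: lattice_points_def)
      moreover have "inverse (real q) * (real_of_int (z i) - real_of_int (rep (res z) i))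
            = real_of_int ((z i - rep (res z) i) div int q)" for i
      proof -
        have "real q * real_of_int ((z i - rep (res z) i) div int q)
              = real_of_int (z i) - real_of_int (rep (res z) i)"
          using arg_cong[OF eq[OF z, of i], of real_of_int] by simp
        then show ?thesis using q by (simp add: field_simps)
      qed
      moreover have "inverse (real q) * (q * s + q * s) = 2 * s" using q by (simp add: field_simps)
      ultimately have "bnd (\<lambda>i. real_of_int ((z i - rep (res z) i) div int q)) (2 * s)"
        by (simp only:)
      then show ?thesis using z rep[OF z] by (auto simp: lattice_points_def)
    qed
    ultimately show "f z \<in> (I \<rightarrow>\<^sub>E {0..<int q}) \<times> lattice_points (2 * s)" by (simp add: f_def)
  qed
  have "card ?G \<le> card ((I \<rightarrow>\<^sub>E {0..<int q}) \<times> lattice_points (2 * s))"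
    using inj sub by (rule card_inj_on_le)
      (use finite_index finite_lattice_points in \<open>auto intro: finite_PiE\<close>)
  also have "\<dots> = q ^ card I * card (lattice_points (2 * s))"
    using finite_index by (simp add: card_cartesian_product card_PiE)
  finally show ?thesis .
qed

section \<open>Packings and maximal packings in the unit ball\<close>

definition packing :: "real \<Rightarrow> ('i \<Rightarrow> real) set \<Rightarrow> bool" where
  "packing \<delta> P \<longleftrightarrow> finite P \<and> (\<forall>x\<in>P. \<forall>y\<in>P. x \<noteq> y \<longrightarrow> \<not> bnd (\<lambda>i. x i - y i) \<delta>)"

text \<open>The usual volume comparison, with lattice points of a fine mesh \<open>h\<close> in place of volume:
  around the points of the packing, rounded to the mesh, balls of radius \<open>3 * \<delta> / 8\<close> are disjoint.\<close>

lemma card_packing: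
  assumes \<delta>: "0 < \<delta>" "\<delta> \<le> 1" and P: "packing \<delta> P" and unit: "\<And>x. x \<in> P \<Longrightarrow> bnd x 1"
  shows "real (card P) \<le> (9 / \<delta>) ^ card I"
proof -
  \<comment> \<open>Rounding coordinates down to multiples of \<open>h\<close> moves a point by at
    most \<open>L * h\<close>, hence by at most \<open>\<delta> / 8\<close>; \<open>L + 1\<close>
    keeps the denominator positive when \<open>L = 0\<close>.\<close>
  define h where "h = \<delta> / (8 * (L + 1))"
  have h: "h > 0" "L * h \<le> \<delta> / 8"
    using \<delta> L_nonneg by (auto simp: h_def field_simps)
  define z where "z x i = (if i \<in> I then \<lfloor>x i / h\<rfloor> else 0)" for x :: "'i \<Rightarrow> real" and i
  have z: "bnd (\<lambda>i. x i - h * z x i) (\<delta> / 8)" for x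
  proof -
    have "\<bar>x i - h * z x i\<bar> \<le> h" if "i \<in> I" for i
    proof -
      have "of_int \<lfloor>x i / h\<rfloor> * h \<le> x i" "x i < (of_int \<lfloor>x i / h\<rfloor> + 1) * h"
        using h(1) by (rule floor_divide_lower, rule floor_divide_upper)
      then have "\<bar>x i - h * of_int \<lfloor>x i / h\<rfloor>\<bar> \<le> h" by (simp add: algebra_simps abs_le_iff)
      then show ?thesis using that by (simp add: z_def)
    qed
    then have "bnd (\<lambda>i. x i - h * z x i) (L * h)" using h(1) by (intro coords_bnd) auto
    then show ?thesis using h(2) by (rule bnd_mono)
  qed
  \<comment> \<open>The radius satisfies
    \<open>\<delta> / 8 + 2 * \<rho> + \<delta> / 8 = \<delta>\<close>, so overlapping balls around
    two rounded points would violate the separation.\<close>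
  define \<rho> where "\<rho> = 3 * \<delta> / 8"
  \<comment> \<open>Two requirements fix \<open>q\<close>. At least \<open>8 / \<delta>\<close>
    makes \<open>q * (\<rho> / 2)\<close> at least \<open>3 / 2\<close>, which bounds the radius
    \<open>1 + \<delta> / 8 + \<rho>\<close> of a ball containing all the small ones; at most
    \<open>9 / \<delta>\<close> gives the final estimate.\<close>
  define q where "q = nat \<lceil>8 / \<delta>\<rceil>"
  have q: "8 / \<delta> \<le> real q" "real q \<le> 9 / \<delta>" "q > 0"
  proof -
    show 1: "8 / \<delta> \<le> real q" unfolding q_def by linarith
    have "1 \<le> 1 / \<delta>" "0 < 1 / \<delta>" using \<delta> by auto
    then have "real q \<le> 8 / \<delta> + 1" unfolding q_def by linarith
    with \<open>1 \<le> 1 / \<delta>\<close> show "real q \<le> 9 / \<delta>" by linarith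
    have "0 < real q" using 1 \<open>0 < 1 / \<delta>\<close> by linarith
    then show "q > 0" by simp
  qed
  let ?G = "lattice_points (\<rho> / h)" and ?H = "lattice_points (q * (\<rho> / (2 * h)))"
  \<comment> \<open>Injectivity of \<open>f\<close> is the disjointness of the translated balls, and
    its image lies in one large ball.\<close>
  define f where "f = (\<lambda>(x, g) i. z x i + g i)"
  have "inj_on f (P \<times> ?G)"
  proof (rule inj_onI, clarify)
    fix x g y g'
    assume x: "x \<in> P" "g \<in> ?G" "y \<in> P" "g' \<in> ?G" and "f (x, g) = f (y, g')"
    then have eq: "z x i + g i = z y i + g' i" for i by (auto simp: f_def dest: fun_cong)
    have "bnd (\<lambda>i. h * (real_of_int (g' i) - real_of_int (g i))) (h * (\<rho> / h + \<rho> / h))"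
      using x h by (intro bnd_scale bnd_diff) (auto simp: lattice_points_def)
    from bnd_add[OF z[of x] bnd_diff[OF this z[of y]]]
    have "bnd (\<lambda>i. (x i - h * z x i) + (h * (real_of_int (g' i) - real_of_int (g i)) - (y i - h * z y i)))
            (\<delta> / 8 + (h * (\<rho> / h + \<rho> / h) + \<delta> / 8))" .
    moreover have "(x i - h * z x i) + (h * (real_of_int (g' i) - real_of_int (g i)) - (y i - h * z y i))
        = x i - y i" for i
    proof -
      have "real_of_int (g' i) - real_of_int (g i) = z x i - z y i"
        using eq[of i] by (simp flip: of_int_diff)
      then show ?thesis by (simp add: right_diff_distrib)
    qed
    ultimately have "bnd (\<lambda>i. x i - y i) (\<delta> / 8 + (h * (\<rho> / h + \<rho> / h) + \<delta> / 8))" by simp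
    moreover have "\<delta> / 8 + (h * (\<rho> / h + \<rho> / h) + \<delta> / 8) = \<delta>"
      using h(1) by (simp add: \<rho>_def field_simps)
    ultimately have "x = y" using P x by (auto simp: packing_def)
    then show "x = y \<and> g = g'" using eq by auto
  qed
  moreover have "f ` (P \<times> ?G) \<subseteq> ?H"
  proof (rule image_subsetI, clarify)
    fix x g assume x: "x \<in> P" "g \<in> ?G"
    have "bnd (\<lambda>i. inverse h * (x i - (x i - h * z x i))) (inverse h * (1 + \<delta> / 8))"
      using z[of x] unit[OF x(1)] h by (intro bnd_scale bnd_diff) auto
    moreover have "(\<lambda>i. inverse h * (x i - (x i - h * z x i))) = (\<lambda>i. real_of_int (z x i))"
      using h(1) by (auto simp: field_simps)
    ultimately have "bnd (\<lambda>i. real_of_int (z x i) + real_of_int (g i)) (inverse h * (1 + \<delta> / 8) + \<rho> / h)"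
      using x by (intro bnd_add) (auto simp: lattice_points_def)
    moreover have "inverse h * (1 + \<delta> / 8) + \<rho> / h \<le> q * (\<rho> / (2 * h))"
    proof -
      have "3 / 2 = (8 / \<delta>) * (\<rho> / 2)" using \<delta> by (simp add: \<rho>_def)
      also have "\<dots> \<le> q * (\<rho> / 2)" using q \<delta> by (intro mult_right_mono) (auto simp: \<rho>_def)
      finally have "3 / 2 \<le> q * (\<rho> / 2)" .
      moreover have "(1 + \<delta> / 8) + \<rho> \<le> 3 / 2" using \<delta> by (simp add: \<rho>_def)
      ultimately have "(1 + \<delta> / 8) + \<rho> \<le> q * (\<rho> / 2)" by linarith
      then have "((1 + \<delta> / 8) + \<rho>) / h \<le> (q * (\<rho> / 2)) / h" using h by (intro divide_right_mono) auto
      moreover have "inverse h * (1 + \<delta> / 8) + \<rho> / h = ((1 + \<delta> / 8) + \<rho>) / h"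
        "q * (\<rho> / (2 * h)) = (q * (\<rho> / 2)) / h"
        using h(1) by (simp_all add: field_simps)
      ultimately show ?thesis by (simp only:)
    qed
    ultimately have "bnd (\<lambda>i. real_of_int (z x i) + real_of_int (g i)) (q * (\<rho> / (2 * h)))"
      by (rule bnd_mono)
    then show "f (x, g) \<in> ?H" using x by (auto simp: f_def lattice_points_def z_def)
  qed
  ultimately have "card (P \<times> ?G) \<le> card ?H"
    by (rule card_inj_on_le) (rule finite_lattice_points)
  also have "\<dots> \<le> q ^ card I * card (lattice_points (2 * (\<rho> / (2 * h))))"
    by (rule card_lattice_points_mult[OF q(3)])
  \<comment> \<open>The halved radius in \<open>?H\<close> makes the ball on the right equal to
    \<open>?G\<close>; as \<open>?G\<close> contains 0, its cardinality cancels.\<close>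
  also have "2 * (\<rho> / (2 * h)) = \<rho> / h" by simp
  finally have "card P * card ?G \<le> q ^ card I * card ?G" by (simp add: card_cartesian_product)
  moreover have "card ?G > 0"
    using zero_lattice_point[of "\<rho> / h"] finite_lattice_points h(1) \<delta>
    by (auto simp: card_gt_0_iff \<rho>_def)
  ultimately have "card P \<le> q ^ card I" by simp
  then have "real (card P) \<le> real q ^ card I" by (metis of_nat_le_iff of_nat_power)
  also have "\<dots> \<le> (9 / \<delta>) ^ card I" using q by (intro power_mono) auto
  finally show ?thesis .
qed

text \<open>The volume bound caps the size of packings inside \<open>S\<close>, so one of greatest
  size exists; a point of \<open>S\<close> not within \<open>\<delta>\<close> of any member could be
  added to it. The centres lie in \<open>S\<close>, so a net of frames consists of frames and a net
  of contractions of contractions.\<close>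

lemma covering:
  assumes \<delta>: "0 < \<delta>" "\<delta> \<le> 1" and unit: "\<And>x. x \<in> S \<Longrightarrow> bnd x 1"
  obtains P where "finite P" "P \<subseteq> S" "real (card P) \<le> (9 / \<delta>) ^ card I"
    "\<And>x. x \<in> S \<Longrightarrow> \<exists>p\<in>P. bnd (\<lambda>i. x i - p i) \<delta>"
proof -
  let ?Q = "\<lambda>P. packing \<delta> P \<and> P \<subseteq> S"
  have bound: "real (card P) \<le> (9 / \<delta>) ^ card I" if "?Q P" for P
    using card_packing[OF \<delta>] that unit by blast
  have "?Q {}" by (simp add: packing_def)
  moreover have "card P < nat \<lceil>(9 / \<delta>) ^ card I\<rceil> + 1" if "?Q P" for P
    using bound[OF that] by linarith
  ultimately obtain P where P: "?Q P" and max: "\<And>P'. ?Q P' \<Longrightarrow> card P' \<le> card P"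
    using ex_has_greatest_nat[of ?Q "{}" card "nat \<lceil>(9 / \<delta>) ^ card I\<rceil> + 1"] by blast
  have "\<exists>p\<in>P. bnd (\<lambda>i. x i - p i) \<delta>" if x: "x \<in> S" for x
  proof (rule ccontr)
    assume *: "\<not> ?thesis"
    then have "x \<notin> P" using bnd_zero[of \<delta>] \<delta> by force
    have "?Q (insert x P)"
      using P x * bnd_commute by (fastforce simp: packing_def)
    then have "card (insert x P) \<le> card P" by (rule max)
    then show False using \<open>x \<notin> P\<close> P by (simp add: packing_def)
  qed
  then show ?thesis using that P bound by (auto simp: packing_def)
qed

end

section \<open>Operator norm bounds\<close>

lemma vec_norm2_nonneg [simp]: "0 \<le> vec_norm2 v"
  by (simp add: vec_norm2_def L2_set_nonneg)

lemma vec_norm2_sq: "(vec_norm2 v)\<^sup>2 = v \<bullet> v"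
  by (simp add: vec_norm2_def L2_set_def scalar_prod_def sum_nonneg lessThan_atLeast0 power2_eq_square)

lemma vec_norm2_zero [simp]: "vec_norm2 (0\<^sub>v n) = 0"
  using vec_norm2_sq[of "0\<^sub>v n"] by simp

lemma vec_norm2_eq_0:
  assumes "v \<in> carrier_vec n"
  shows "vec_norm2 v = 0 \<longleftrightarrow> v = 0\<^sub>v n"
  using assms by (auto simp: vec_norm2_def L2_set_eq_0_iff intro!: eq_vecI)

lemma vec_norm2_smult: "vec_norm2 (c \<cdot>\<^sub>v v) = \<bar>c\<bar> * vec_norm2 v"
proof -
  have "(vec_norm2 (c \<cdot>\<^sub>v v))\<^sup>2 = (\<bar>c\<bar> * vec_norm2 v)\<^sup>2"
    by (simp add: vec_norm2_sq power_mult_distrib power2_eq_square[of c])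
  then show ?thesis by (simp add: power2_eq_iff_nonneg)
qed

lemma vec_norm2_add_le:
  assumes "u \<in> carrier_vec n" "v \<in> carrier_vec n"
  shows "vec_norm2 (u + v) \<le> vec_norm2 u + vec_norm2 v"
proof -
  have "vec_norm2 (u + v) = L2_set (\<lambda>i. u $ i + v $ i) {..<n}"
    using assms by (auto simp: vec_norm2_def intro!: L2_set_cong)
  also have "\<dots> \<le> L2_set (vec_index u) {..<n} + L2_set (vec_index v) {..<n}"
    by (rule L2_set_triangle_ineq)
  finally show ?thesis using assms by (simp add: vec_norm2_def)
qed

lemma scalar_prod_le_vec_norm2:
  assumes "u \<in> carrier_vec n" "v \<in> carrier_vec n"
  shows "\<bar>u \<bullet> v\<bar> \<le> vec_norm2 u * vec_norm2 v"
proof -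
  have "\<bar>u \<bullet> v\<bar> \<le> (\<Sum>i<n. \<bar>u $ i\<bar> * \<bar>v $ i\<bar>)"
    using assms by (simp add: scalar_prod_def lessThan_atLeast0 flip: abs_mult)
  also have "\<dots> \<le> vec_norm2 u * vec_norm2 v"
    using L2_set_mult_ineq[of "vec_index u" "vec_index v" "{..<n}"] assms by (simp add: vec_norm2_def)
  finally show ?thesis .
qed

lemma vec_index_le_vec_norm2:
  assumes "i < dim_vec v"
  shows "\<bar>v $ i\<bar> \<le> vec_norm2 v"
proof -
  have "\<bar>v $ i\<bar> \<le> L2_set (\<lambda>i. \<bar>v $ i\<bar>) {..<dim_vec v}"
    by (rule member_le_L2_set) (use assms in auto)
  then show ?thesis by (simp add: vec_norm2_def L2_set_def)
qed

lemma vec_norm2_le_sum: "vec_norm2 v \<le> (\<Sum>i<dim_vec v. \<bar>v $ i\<bar>)"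
  unfolding vec_norm2_def by (rule L2_set_le_sum_abs)

text \<open>Unlike \<^const>\<open>mat_opnorm\<close>, this is meaningful for matrices without columns, which occur as
  complements of full frames.\<close>

definition op_bounded :: "real mat \<Rightarrow> real \<Rightarrow> bool" where
  "op_bounded W c \<longleftrightarrow> (\<forall>x\<in>carrier_vec (dim_col W). vec_norm2 (W *\<^sub>v x) \<le> c * vec_norm2 x)"

lemma op_boundedI:
  assumes "W \<in> carrier_mat a b" "\<And>x. x \<in> carrier_vec b \<Longrightarrow> vec_norm2 (W *\<^sub>v x) \<le> c * vec_norm2 x"
  shows "op_bounded W c"
  using assms by (auto simp: op_bounded_def)

lemma op_boundedD:
  assumes "op_bounded W c" "W \<in> carrier_mat a b" "x \<in> carrier_vec b"
  shows "vec_norm2 (W *\<^sub>v x) \<le> c * vec_norm2 x"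
  using assms by (auto simp: op_bounded_def)

lemma op_bounded_mono: "op_bounded W c \<Longrightarrow> c \<le> c' \<Longrightarrow> op_bounded W c'"
  unfolding op_bounded_def by (meson mult_right_mono order_trans vec_norm2_nonneg)

text \<open>The supremum dominates every quotient because the quotients are bounded above; the zero
  vector, left out of the supremum, is mapped to zero.\<close>

lemma op_bounded_opnorm: "op_bounded W (mat_opnorm W)"
  unfolding op_bounded_def
proof
  fix x :: "real vec" assume x: "x \<in> carrier_vec (dim_col W)"
  show "vec_norm2 (W *\<^sub>v x) \<le> mat_opnorm W * vec_norm2 x"
  proof (cases "x = 0\<^sub>v (dim_col W)")
    case True
    have "W *\<^sub>v 0\<^sub>v (dim_col W) = 0\<^sub>v (dim_row W)" by (intro eq_vecI) auto
    then show ?thesis using True by simp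
  next
    case False
    then have "vec_norm2 x > 0" using vec_norm2_eq_0[OF x] vec_norm2_nonneg[of x] by linarith
    moreover have "vec_norm2 (W *\<^sub>v x) / vec_norm2 x \<le> mat_opnorm W"
      unfolding mat_opnorm_def using x False bdd_above_mat_opnorm by (intro cSUP_upper) auto
    ultimately show ?thesis by (simp add: divide_le_eq)
  qed
qed

lemma op_bounded_add:
  assumes "op_bounded X c" "op_bounded Y c'" "X \<in> carrier_mat a b" "Y \<in> carrier_mat a b"
  shows "op_bounded (X + Y) (c + c')"
proof (rule op_boundedI[of _ a b])
  fix x :: "real vec" assume x: "x \<in> carrier_vec b"
  have "vec_norm2 ((X + Y) *\<^sub>v x) \<le> vec_norm2 (X *\<^sub>v x) + vec_norm2 (Y *\<^sub>v x)"
    using assms x by (simp add: add_mult_distrib_mat_vec vec_norm2_add_le[of _ a])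
  also have "\<dots> \<le> c * vec_norm2 x + c' * vec_norm2 x"
    using assms x by (intro add_mono op_boundedD[of _ _ a b])
  finally show "vec_norm2 ((X + Y) *\<^sub>v x) \<le> (c + c') * vec_norm2 x" by (simp add: algebra_simps)
qed (use assms in auto)

lemma op_bounded_smult:
  assumes "op_bounded X c" "X \<in> carrier_mat a b"
  shows "op_bounded (s \<cdot>\<^sub>m X) (\<bar>s\<bar> * c)"
proof (rule op_boundedI[of _ a b])
  fix x :: "real vec" assume x: "x \<in> carrier_vec b"
  have "(s \<cdot>\<^sub>m X) *\<^sub>v x = s \<cdot>\<^sub>v (X *\<^sub>v x)" using assms x by (intro eq_vecI) auto
  then show "vec_norm2 ((s \<cdot>\<^sub>m X) *\<^sub>v x) \<le> \<bar>s\<bar> * c * vec_norm2 x"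
    using op_boundedD[OF assms x] by (simp add: vec_norm2_smult mult_left_mono mult.assoc)
qed (use assms in auto)

lemma op_bounded_minus:
  assumes "op_bounded X c" "op_bounded Y c'" "X \<in> carrier_mat a b" "Y \<in> carrier_mat a b"
  shows "op_bounded (X - Y) (c + c')"
proof -
  have "X - Y = X + (-1) \<cdot>\<^sub>m Y" using assms by auto
  then show ?thesis using op_bounded_add[OF assms(1) op_bounded_smult[OF assms(2,4), of "-1"]] assms by simp
qed

lemma op_bounded_mult:
  assumes "op_bounded X c" "op_bounded Y c'" "X \<in> carrier_mat a b" "Y \<in> carrier_mat b e" "0 \<le> c"
  shows "op_bounded (X * Y) (c * c')"
proof (rule op_boundedI[of _ a e])
  fix x :: "real vec" assume x: "x \<in> carrier_vec e"
  have "vec_norm2 ((X * Y) *\<^sub>v x) = vec_norm2 (X *\<^sub>v (Y *\<^sub>v x))"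
    using assms x by (simp add: assoc_mult_mat_vec[of _ a b _ e])
  also have "\<dots> \<le> c * vec_norm2 (Y *\<^sub>v x)" using assms x by (intro op_boundedD[of _ _ a b]) auto
  also have "\<dots> \<le> c * (c' * vec_norm2 x)"
    using assms x by (intro mult_left_mono op_boundedD[of _ _ b e]) auto
  finally show "vec_norm2 ((X * Y) *\<^sub>v x) \<le> c * c' * vec_norm2 x" by simp
qed (use assms in auto)

text \<open>With z the image of y under the transpose, |z|^2 is the scalar product of y with
  \<open>X\<close> z, hence at most |y| c |z| by Cauchy-Schwarz; it remains to divide by
  |z|.\<close>

lemma op_bounded_transpose:
  assumes "op_bounded X c" "X \<in> carrier_mat a b" "0 \<le> c"
  shows "op_bounded (transpose_mat X) c"
proof (rule op_boundedI[of _ b a])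
  fix y :: "real vec" assume y: "y \<in> carrier_vec a"
  let ?z = "transpose_mat X *\<^sub>v y"
  have z: "?z \<in> carrier_vec b" using assms y by auto
  have "vec_norm2 ?z * vec_norm2 ?z = y \<bullet> (X *\<^sub>v ?z)"
    using transpose_vec_mult_scalar[OF assms(2) z y] vec_norm2_sq[of ?z]
    by (simp add: power2_eq_square)
  also have "\<dots> \<le> vec_norm2 y * vec_norm2 (X *\<^sub>v ?z)"
    using scalar_prod_le_vec_norm2[OF y mult_mat_vec_carrier[OF assms(2) z]] by linarith
  also have "\<dots> \<le> vec_norm2 y * (c * vec_norm2 ?z)"
    using op_boundedD[OF assms(1,2) z] by (intro mult_left_mono) auto
  finally have "vec_norm2 ?z * vec_norm2 ?z \<le> (c * vec_norm2 y) * vec_norm2 ?z"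
    by (simp add: mult_ac)
  then show "vec_norm2 ?z \<le> c * vec_norm2 y"
    using assms(3) vec_norm2_nonneg[of ?z] vec_norm2_nonneg[of y]
    by (cases "vec_norm2 ?z = 0") auto
qed (use assms in auto)

lemma op_bounded_entry:
  assumes "op_bounded X c" "X \<in> carrier_mat a b" "i < a" "j < b"
  shows "\<bar>X $$ (i, j)\<bar> \<le> c"
proof -
  have "\<bar>X $$ (i, j)\<bar> = \<bar>(X *\<^sub>v unit_vec b j) $ i\<bar>"
    using assms by simp
  also have "\<dots> \<le> vec_norm2 (X *\<^sub>v unit_vec b j)" using assms by (intro vec_index_le_vec_norm2) auto
  also have "\<dots> \<le> c * vec_norm2 (unit_vec b j)" using assms by (intro op_boundedD[of _ _ a b]) auto
  also have "vec_norm2 (unit_vec b j :: real vec) = 1"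
    using vec_norm2_sq[of "unit_vec b j"] assms power2_eq_iff_nonneg[of "vec_norm2 (unit_vec b j)" 1]
    by simp
  finally show ?thesis by simp
qed

text \<open>The crude factor \<open>a * b\<close> is harmless: it becomes \<open>L\<close>, which
  enters the mesh width but not the size of the nets.\<close>

lemma entries_op_bounded:
  assumes "X \<in> carrier_mat a b" "\<And>i j. i < a \<Longrightarrow> j < b \<Longrightarrow> \<bar>X $$ (i, j)\<bar> \<le> t"
  shows "op_bounded X (real (a * b) * t)"
proof (rule op_boundedI[OF assms(1)])
  fix x :: "real vec" assume x: "x \<in> carrier_vec b"
  have "vec_norm2 (X *\<^sub>v x) \<le> (\<Sum>i<a. \<bar>(X *\<^sub>v x) $ i\<bar>)"
    using vec_norm2_le_sum[of "X *\<^sub>v x"] assms by simp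
  also have "\<dots> \<le> (\<Sum>i<a. \<Sum>j<b. t * vec_norm2 x)"
  proof (rule sum_mono)
    fix i assume "i \<in> {..<a}"
    then have "\<bar>(X *\<^sub>v x) $ i\<bar> = \<bar>\<Sum>j<b. X $$ (i, j) * x $ j\<bar>"
      using x assms by (simp add: scalar_prod_def atLeast0LessThan)
    also have "\<dots> \<le> (\<Sum>j<b. \<bar>X $$ (i, j) * x $ j\<bar>)" by (rule sum_abs)
    also have "\<dots> \<le> (\<Sum>j<b. t * vec_norm2 x)"
    proof (rule sum_mono)
      fix j assume "j \<in> {..<b}"
      with \<open>i \<in> {..<a}\<close> show "\<bar>X $$ (i, j) * x $ j\<bar> \<le> t * vec_norm2 x"
        unfolding abs_mult using assms(2)[of i j] x
        by (intro mult_mono vec_index_le_vec_norm2) (auto intro: order_trans[OF abs_ge_zero])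
    qed
    finally show "\<bar>(X *\<^sub>v x) $ i\<bar> \<le> (\<Sum>j<b. t * vec_norm2 x)" .
  qed
  finally show "vec_norm2 (X *\<^sub>v x) \<le> real (a * b) * t * vec_norm2 x" by (simp add: mult.assoc)
qed

section \<open>Nets of matrices in the operator norm\<close>

text \<open>Matrices are read as functions on index pairs, so that \<open>card I\<close> is the
  number \<open>a * b\<close> of entries; \<open>mat a b\<close> discards values outside the index
  set.\<close>

lemma bounding_mat:
  "bounding ({..<a} \<times> {..<b}) (\<lambda>f c. op_bounded (mat a b f) c) (real (a * b))"
proof
  show "op_bounded (mat a b (\<lambda>i. x i - y i)) (c + c')"
    if "op_bounded (mat a b x) c" "op_bounded (mat a b y) c'" for x y c c'
  proof -
    have "mat a b (\<lambda>i. x i - y i) = mat a b x - mat a b y" by (intro eq_matI) auto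
    then show ?thesis using op_bounded_minus[OF that, of a b] by simp
  qed
  show "op_bounded (mat a b (\<lambda>i. s * x i)) (s * c)" if "op_bounded (mat a b x) c" "0 \<le> s" for x c s
  proof -
    have "mat a b (\<lambda>i. s * x i) = s \<cdot>\<^sub>m mat a b x" by (intro eq_matI) auto
    then show ?thesis using op_bounded_smult[OF that(1), of a b s] that by simp
  qed
  show "\<bar>x i\<bar> \<le> c" if "op_bounded (mat a b x) c" "i \<in> {..<a} \<times> {..<b}" for x c i
    using op_bounded_entry[OF that(1), of a b "fst i" "snd i"] that(2) by auto
  show "op_bounded (mat a b x) (real (a * b) * t)"
    if "\<And>i. i \<in> {..<a} \<times> {..<b} \<Longrightarrow> \<bar>x i\<bar> \<le> t" for x t
    using that by (intro entries_op_bounded[of _ a b]) auto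
qed (auto intro: op_bounded_mono)

text \<open>\<open>S\<close> is kept general because it is taken to be the set of orthonormal frames
  in one place and the set of all contractions in another.\<close>

lemma mat_covering:
  assumes S: "S \<subseteq> carrier_mat a b" and unit: "\<And>X. X \<in> S \<Longrightarrow> op_bounded X 1"
    and \<delta>: "0 < \<delta>" "\<delta> \<le> 1"
  obtains P where "finite P" "P \<subseteq> S" "real (card P) \<le> (9 / \<delta>) ^ (a * b)"
    "\<And>X. X \<in> S \<Longrightarrow> \<exists>Y\<in>P. op_bounded (X - Y) \<delta>"
proof -
  interpret bounding "{..<a} \<times> {..<b}" "\<lambda>f c. op_bounded (mat a b f) c" "real (a * b)"
    by (rule bounding_mat)
  have mat_id: "mat a b (\<lambda>ij. X $$ ij) = X" if "X \<in> S" for X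
    using that S by (intro eq_matI) auto
  have "op_bounded (mat a b x) 1" if "x \<in> (\<lambda>X ij. X $$ ij) ` S" for x
    using that unit mat_id by auto
  from covering[OF \<delta> this]
  obtain P where P: "finite P" "P \<subseteq> (\<lambda>X ij. X $$ ij) ` S"
    "real (card P) \<le> (9 / \<delta>) ^ card ({..<a} \<times> {..<b})"
    "\<And>x. x \<in> (\<lambda>X ij. X $$ ij) ` S \<Longrightarrow> \<exists>p\<in>P. op_bounded (mat a b (\<lambda>i. x i - p i)) \<delta>"
    by auto
  show thesis
  proof
    show "finite (mat a b ` P)" using P by simp
    show "mat a b ` P \<subseteq> S" using P(2) mat_id by auto
    show "real (card (mat a b ` P)) \<le> (9 / \<delta>) ^ (a * b)"
      using P(3) card_image_le[OF P(1), of "mat a b"] by (simp add: card_cartesian_product)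
    show "\<exists>Y\<in>mat a b ` P. op_bounded (X - Y) \<delta>" if X: "X \<in> S" for X
    proof -
      obtain p where p: "p \<in> P" "op_bounded (mat a b (\<lambda>i. X $$ i - p i)) \<delta>" using P(4) X by blast
      moreover have "mat a b (\<lambda>i. X $$ i - p i) = X - mat a b p"
        using X S by (intro eq_matI) auto
      ultimately show ?thesis by auto
    qed
  qed
qed

section \<open>Orthonormal frames\<close>

definition orthonormal :: "nat \<Rightarrow> nat \<Rightarrow> real mat \<Rightarrow> bool" where
  "orthonormal k m U \<longleftrightarrow> U \<in> carrier_mat k m \<and> transpose_mat U * U = 1\<^sub>m m"

definition mat_range :: "real mat \<Rightarrow> real vec set" where
  "mat_range U = (\<lambda>b. U *\<^sub>v b) ` carrier_vec (dim_col U)"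

definition extends_cols :: "real mat \<Rightarrow> real mat \<Rightarrow> bool" where
  "extends_cols U U' \<longleftrightarrow> dim_row U = dim_row U' \<and> dim_col U \<le> dim_col U' \<and>
     (\<forall>i<dim_row U. \<forall>j<dim_col U. U' $$ (i, j) = U $$ (i, j))"

lemma orthonormal_carrier: "orthonormal k m U \<Longrightarrow> U \<in> carrier_mat k m"
  by (simp add: orthonormal_def)

lemma transpose_mult_vec_index:
  assumes "U \<in> carrier_mat k m" "j < m" "v \<in> carrier_vec k"
  shows "(transpose_mat U *\<^sub>v v) $ j = (\<Sum>i<k. U $$ (i, j) * v $ i)"
  using assms by (simp add: scalar_prod_def lessThan_atLeast0)

lemma orthonormal_iff_entries:
  assumes "U \<in> carrier_mat k m"
  shows "orthonormal k m U \<longleftrightarrow>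
    (\<forall>i<m. \<forall>j<m. (\<Sum>l<k. U $$ (l, i) * U $$ (l, j)) = (if i = j then 1 else 0))"
  using assms by (auto simp: orthonormal_def mat_eq_iff scalar_prod_def lessThan_atLeast0)

lemma orthonormal_mult_vec:
  assumes "orthonormal k m U" "b \<in> carrier_vec m"
  shows "transpose_mat U *\<^sub>v (U *\<^sub>v b) = b"
  using assms assoc_mult_mat_vec[of "transpose_mat U" m k U m b] by (simp add: orthonormal_def)

text \<open>Coefficients are padded with zeros for the additional columns.\<close>

lemma mat_range_extends:
  assumes "extends_cols U U'"
  shows "mat_range U \<subseteq> mat_range U'"
proof
  fix x assume "x \<in> mat_range U"
  then obtain b where b: "b \<in> carrier_vec (dim_col U)" and x: "x = U *\<^sub>v b"
    by (auto simp: mat_range_def)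
  define b' where "b' = vec (dim_col U') (\<lambda>j. if j < dim_col U then b $ j else 0)"
  have "U' *\<^sub>v b' = U *\<^sub>v b"
  proof (rule eq_vecI)
    fix i assume i: "i < dim_vec (U *\<^sub>v b)"
    have "(U' *\<^sub>v b') $ i = (\<Sum>j<dim_col U'. U' $$ (i, j) * (if j < dim_col U then b $ j else 0))"
      using assms i by (simp add: scalar_prod_def lessThan_atLeast0 b'_def extends_cols_def)
    also have "\<dots> = (\<Sum>j<dim_col U. U $$ (i, j) * b $ j)"
      using assms i by (intro sum.mono_neutral_cong_right) (auto simp: extends_cols_def)
    also have "\<dots> = (U *\<^sub>v b) $ i"
      using i b by (simp add: scalar_prod_def lessThan_atLeast0)
    finally show "(U' *\<^sub>v b') $ i = (U *\<^sub>v b) $ i" .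
  qed (use assms in \<open>auto simp: extends_cols_def\<close>)
  then show "x \<in> mat_range U'" using x by (auto simp: mat_range_def b'_def intro!: image_eqI[of _ _ b'])
qed

lemma orthonormal_proj_mat_range:
  assumes "orthonormal k m U" "x \<in> mat_range U"
  shows "U *\<^sub>v (transpose_mat U *\<^sub>v x) = x"
  using assms orthonormal_carrier[OF assms(1)] orthonormal_mult_vec[OF assms(1)]
  by (auto simp: mat_range_def)

section \<open>Extension of orthonormal frames\<close>

text \<open>The transpose of \<open>U\<close> is filled up with zero rows to a square matrix
  \<open>A\<close>. Since \<open>m < k\<close> there is at least one such row, so
  \<open>det A = 0\<close>, and a kernel vector of \<open>A\<close> is orthogonal to all columns of
  \<open>U\<close>.\<close>

lemma exists_orthogonal_vec:
  assumes U: "U \<in> carrier_mat k m" and "m < k"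
  obtains v :: "real vec" where "v \<in> carrier_vec k" "v \<noteq> 0\<^sub>v k" "transpose_mat U *\<^sub>v v = 0\<^sub>v m"
proof -
  define c where "c i = vec k (\<lambda>j. if i < m then U $$ (j, i) else 0)" for i
  define A where "A = mat\<^sub>r k k (\<lambda>i. if i = m then 0\<^sub>v k else c i)"
  have A: "A \<in> carrier_mat k k" by (simp add: A_def)
  have "det A = 0" unfolding A_def by (rule det_row_0[OF \<open>m < k\<close>]) (auto simp: c_def)
  then obtain v where v: "v \<in> carrier_vec k" "v \<noteq> 0\<^sub>v k" "A *\<^sub>v v = 0\<^sub>v k"
    using det_0_iff_vec_prod_zero_field[OF A] by auto
  have "transpose_mat U *\<^sub>v v = 0\<^sub>v m"
  proof (rule eq_vecI)
    fix i assume "i < dim_vec (0\<^sub>v m :: real vec)"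
    then have i: "i < m" by simp
    have "(A *\<^sub>v v) $ i = row A i \<bullet> v" using i A \<open>m < k\<close> by simp
    also have "row A i = col U i"
      using i U \<open>m < k\<close> by (intro eq_vecI) (auto simp: A_def c_def)
    finally show "(transpose_mat U *\<^sub>v v) $ i = 0\<^sub>v m $ i" using v i U \<open>m < k\<close> by simp
  qed (use U in auto)
  then show thesis using that v by blast
qed

text \<open>The new column is \<open>w\<close> normalised to length 1. Then \<open>w\<close> is
  \<open>s\<close> times that column, so \<open>U *\<^sub>v a + w\<close> has the coefficients
  \<open>a\<close> followed by \<open>s\<close>.\<close>

lemma orthonormal_snoc:
  assumes U: "orthonormal k m U" and w: "w \<in> carrier_vec k" "w \<noteq> 0\<^sub>v k" "transpose_mat U *\<^sub>v w = 0\<^sub>v m"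
  obtains U' where "orthonormal k (Suc m) U'" "extends_cols U U'"
    "\<And>a. a \<in> carrier_vec m \<Longrightarrow> U *\<^sub>v a + w \<in> mat_range U'"
proof -
  define s where "s = vec_norm2 w"
  have s: "s > 0" using vec_norm2_eq_0[OF w(1)] w(2) vec_norm2_nonneg[of w] unfolding s_def by linarith
  define U' where "U' = mat k (Suc m) (\<lambda>(i, j). if j < m then U $$ (i, j) else w $ i / s)"
  have Uc: "U \<in> carrier_mat k m" using U by (rule orthonormal_carrier)
  have perp: "(\<Sum>l<k. U $$ (l, i) * w $ l) = 0" if "i < m" for i
    using transpose_mult_vec_index[OF Uc that w(1)] w(3) that by simp
  have unit: "(\<Sum>l<k. w $ l / s * (w $ l / s)) = 1"
  proof -
    have "(\<Sum>l<k. w $ l * w $ l) = s * s"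
      using vec_norm2_sq[of w] w(1) by (simp add: s_def scalar_prod_def lessThan_atLeast0 power2_eq_square)
    then show ?thesis using s by (simp flip: sum_divide_distrib)
  qed
  have "orthonormal k (Suc m) U'"
  proof (subst orthonormal_iff_entries, simp add: U'_def, intro allI impI)
    fix i j assume ij: "i < Suc m" "j < Suc m"
    consider "i < m" "j < m" | "i < m" "j = m" | "i = m" "j < m" | "i = m" "j = m" using ij by linarith
    then show "(\<Sum>l<k. U' $$ (l, i) * U' $$ (l, j)) = (if i = j then 1 else 0)"
    proof cases
      case 1
      then show ?thesis using U Uc by (simp add: orthonormal_iff_entries U'_def)
    next
      case 2
      then show ?thesis using perp[of i] by (simp add: U'_def flip: sum_divide_distrib)
    next
      case 3
      then show ?thesis using perp[of j] by (simp add: U'_def mult.commute flip: sum_divide_distrib)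
    next
      case 4
      then show ?thesis using unit by (simp add: U'_def)
    qed
  qed
  moreover have "extends_cols U U'" using Uc by (auto simp: extends_cols_def U'_def)
  moreover have "U *\<^sub>v a + w \<in> mat_range U'" if a: "a \<in> carrier_vec m" for a
  proof -
    define a' where "a' = vec (Suc m) (\<lambda>j. if j < m then a $ j else s)"
    have "U *\<^sub>v a + w = U' *\<^sub>v a'"
      using Uc w(1) a s
      by (intro eq_vecI) (auto simp: U'_def a'_def scalar_prod_def lessThan_atLeast0[symmetric])
    then show ?thesis by (auto simp: mat_range_def U'_def a'_def intro!: image_eqI[of _ _ a'])
  qed
  ultimately show thesis using that by blast
qed

text \<open>A Gram-Schmidt step with residual \<open>w\<close>. If \<open>w\<close> is zero then
  \<open>x\<close> is already in the range, and an arbitrary orthogonal vector is appended so that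
  the number of columns still grows by one.\<close>

lemma orthonormal_extend_one:
  assumes U: "orthonormal k m U" and x: "x \<in> carrier_vec k" and "m < k"
  obtains U' where "orthonormal k (Suc m) U'" "extends_cols U U'" "x \<in> mat_range U'"
proof -
  have Uc: "U \<in> carrier_mat k m" using U by (rule orthonormal_carrier)
  let ?a = "transpose_mat U *\<^sub>v x"
  have a: "?a \<in> carrier_vec m" using Uc x by auto
  define w where "w = x - U *\<^sub>v ?a"
  have w: "w \<in> carrier_vec k" using Uc x by (auto simp: w_def)
  have xw: "U *\<^sub>v ?a + w = x" using Uc x by (auto simp: w_def)
  show thesis
  proof (cases "w = 0\<^sub>v k")
    case False
    have "transpose_mat U *\<^sub>v w = 0\<^sub>v m"
      using Uc x a orthonormal_mult_vec[OF U a] by (simp add: w_def mult_minus_distrib_mat_vec[of _ m k])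
    from orthonormal_snoc[OF U w False this] that show thesis using a xw by metis
  next
    case True
    then have "x \<in> mat_range U" using Uc a xw by (auto simp: mat_range_def intro!: image_eqI[of _ _ ?a])
    moreover obtain v where "v \<in> carrier_vec k" "v \<noteq> 0\<^sub>v k" "transpose_mat U *\<^sub>v v = 0\<^sub>v m"
      using exists_orthogonal_vec[OF Uc \<open>m < k\<close>] .
    ultimately show thesis using orthonormal_snoc[OF U] mat_range_extends that by (metis subsetD)
  qed
qed

lemma extends_cols_refl: "extends_cols U U"
  by (simp add: extends_cols_def)

lemma extends_cols_trans: "extends_cols U V \<Longrightarrow> extends_cols V W \<Longrightarrow> extends_cols U W"
  by (auto simp: extends_cols_def)

text \<open>Exactly \<open>n\<close> columns are added even when the vectors are dependent, which
  prescribes the size of the frame. This serves to enclose a column space in the range of an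
  \<open>r\<close>-frame and, with zero vectors as \<open>x\<close>, to complete a frame to an
  orthonormal basis.\<close>

lemma orthonormal_extend:
  assumes U: "orthonormal k m U" and x: "\<And>i. i < n \<Longrightarrow> x i \<in> carrier_vec k" and "m + n \<le> k"
  obtains U' where "orthonormal k (m + n) U'" "extends_cols U U'" "\<And>i. i < n \<Longrightarrow> x i \<in> mat_range U'"
proof -
  have "\<exists>U'. orthonormal k (m + n) U' \<and> extends_cols U U' \<and> (\<forall>i<n. x i \<in> mat_range U')"
    using x \<open>m + n \<le> k\<close>
  proof (induction n)
    case 0
    then show ?case using U extends_cols_refl by auto
  next
    case (Suc n)
    then obtain U' where U': "orthonormal k (m + n) U'" "extends_cols U U'" "\<forall>i<n. x i \<in> mat_range U'"
      by auto
    obtain U'' where "orthonormal k (Suc (m + n)) U''" "extends_cols U' U''" "x n \<in> mat_range U''"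
      using orthonormal_extend_one[OF U'(1), of "x n"] Suc.prems by auto
    then show ?case using U' extends_cols_trans[OF U'(2)] mat_range_extends[of U' U'']
      by (intro exI[of _ U'']) (auto simp: less_Suc_eq)
  qed
  then show thesis using that by blast
qed

lemma orthonormal_empty: "orthonormal k 0 (0\<^sub>m k 0)"
  by (auto simp: orthonormal_def)

section \<open>Frames for the column space of a low-rank matrix\<close>

lemma submodule_mat_range:
  assumes U: "U \<in> carrier_mat k m"
  shows "submodule class_ring (mat_range U) (module_vec TYPE(real) k)"
proof -
  interpret vec_space "TYPE(real)" k .
  show ?thesis
  proof
    show "mat_range U \<subseteq> carrier (module_vec TYPE(real) k)"
      using U by (auto simp: mat_range_def module_vec_simps)
    show "v \<oplus>\<^bsub>module_vec TYPE(real) k\<^esub> w \<in> mat_range U" if vw: "v \<in> mat_range U" "w \<in> mat_range U" for v w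
    proof -
      obtain a b where "a \<in> carrier_vec m" "b \<in> carrier_vec m" "v = U *\<^sub>v a" "w = U *\<^sub>v b"
        using vw U by (auto simp: mat_range_def)
      then show ?thesis using U
        by (auto simp: mat_range_def module_vec_simps mult_add_distrib_mat_vec[of _ k m]
            intro!: image_eqI[of _ _ "a + b"])
    qed
    have "U *\<^sub>v 0\<^sub>v m = 0\<^sub>v k" using U by (intro eq_vecI) auto
    then show "\<zero>\<^bsub>module_vec TYPE(real) k\<^esub> \<in> mat_range U"
      using U by (auto simp: mat_range_def module_vec_simps intro!: image_eqI[of _ _ "0\<^sub>v m"])
    show "c \<odot>\<^bsub>module_vec TYPE(real) k\<^esub> v \<in> mat_range U" if v: "v \<in> mat_range U" for c v
    proof -
      obtain a where "a \<in> carrier_vec m" "v = U *\<^sub>v a" using v U by (auto simp: mat_range_def)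
      then show ?thesis using U
        by (auto simp: mat_range_def module_vec_simps mult_mat_vec[of _ k m]
            intro!: image_eqI[of _ _ "c \<cdot>\<^sub>v a"])
    qed
  qed
qed

text \<open>A maximal independent set \<open>S\<close> of columns has at most \<open>r\<close>
  elements, so some \<open>r\<close>-frame has \<open>S\<close> in its range. By maximality all
  columns lie in the span of \<open>S\<close>, hence in that range, on which
  \<open>U * transpose_mat U\<close> acts as the identity.\<close>

lemma low_rank_orthonormal:
  assumes W: "W \<in> carrier_mat k d" and rank: "vec_space.rank k W \<le> r" and "r \<le> k"
  obtains U where "orthonormal k r U" "U * (transpose_mat U * W) = W"
proof -
  interpret vec_space "TYPE(real)" k .
  let ?P = "\<lambda>T. T \<subseteq> set (cols W) \<and> lin_indpt T"
  have cols: "set (cols W) \<subseteq> carrier_vec k" using W cols_dim by blast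
  have "?P {}" by (simp add: lin_dep_def)
  then obtain S where S: "finite S" "maximal S ?P"
    using maximal_exists_superset[of "set (cols W)" ?P "{}"] by auto
  then have SP: "S \<subseteq> set (cols W)" "lin_indpt S" by (auto simp: maximal_def)
  have card: "card S \<le> r" using rank rank_card_indpt[OF W S(2)] by simp
  obtain f where f: "bij_betw f {0..<card S} S" using ex_bij_betw_nat_finite[OF S(1)] by blast
  \<comment> \<open>Zero vectors fill the list up to length \<open>r\<close>, so that the frame has
    exactly \<open>r\<close> columns even if the rank is smaller.\<close>
  define x where "x i = (if i < card S then f i else 0\<^sub>v k)" for i
  have "x i \<in> carrier_vec k" for i
    using f SP cols by (force simp: x_def bij_betw_def)
  then obtain U where U: "orthonormal k (0 + r) U" "\<And>i. i < r \<Longrightarrow> x i \<in> mat_range U"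
    using orthonormal_extend[OF orthonormal_empty, of r x k] \<open>r \<le> k\<close> by (metis add_0)
  have Uc: "U \<in> carrier_mat k r" using U(1) orthonormal_carrier by simp
  have "S \<subseteq> mat_range U"
  proof
    fix v assume "v \<in> S"
    then obtain i where "i < card S" "f i = v" using f by (force simp: bij_betw_def)
    then show "v \<in> mat_range U" using U(2)[of i] card by (simp add: x_def)
  qed
  then have span: "span S \<subseteq> mat_range U" using submodule_mat_range[OF Uc] by (rule span_is_subset)
  have in_range: "v \<in> mat_range U" if v: "v \<in> set (cols W)" for v
  proof (cases "v \<in> S")
    case True
    then show ?thesis using \<open>S \<subseteq> mat_range U\<close> by blast
  next
    case False
    have "\<not> ?P (S \<union> {v})" using S(2) False unfolding maximal_def by blast
    then have "lin_dep (S \<union> {v})" using v SP by blast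
    then have "v \<in> span S" using lin_dep_iff_in_span[of S v] SP cols v False by auto
    then show ?thesis using span by blast
  qed
  have "U * (transpose_mat U * W) = W"
  proof (rule mat_col_eqI)
    fix j assume "j < dim_col W"
    then have j: "j < d" using W by simp
    have UW: "transpose_mat U * W \<in> carrier_mat r d" using Uc W by simp
    have "col (U * (transpose_mat U * W)) j = U *\<^sub>v col (transpose_mat U * W) j"
      by (rule col_mult2[OF Uc UW j])
    also have "col (transpose_mat U * W) j = transpose_mat U *\<^sub>v col W j"
      by (rule col_mult2[OF _ W j]) (use Uc in simp)
    also have "U *\<^sub>v (transpose_mat U *\<^sub>v col W j) = col W j"
      using U(1) in_range[of "col W j"] W j by (intro orthonormal_proj_mat_range) (auto simp: cols_def)
    finally show "col (U * (transpose_mat U * W)) j = col W j" .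
  qed (use Uc W in auto)
  then show thesis using that U(1) by simp
qed

section \<open>Pairs of complementary frames\<close>

text \<open>The columns of \<open>U\<close> and \<open>V\<close> together are an orthonormal basis.
  The last equation resolves the identity into the two projections, which is what the norm
  computation and the chart rely on.\<close>

definition frame_pair :: "nat \<Rightarrow> nat \<Rightarrow> real mat \<Rightarrow> real mat \<Rightarrow> bool" where
  "frame_pair k m U V \<longleftrightarrow> orthonormal k m U \<and> orthonormal k (k - m) V \<and>
     transpose_mat V * U = 0\<^sub>m (k - m) m \<and>
     U * transpose_mat U + V * transpose_mat V = 1\<^sub>m k"

lemma frame_pair_commute:
  assumes "frame_pair k m U V" "m \<le> k"
  shows "frame_pair k (k - m) V U"
proof -
  have U: "U \<in> carrier_mat k m" and V: "V \<in> carrier_mat k (k - m)"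
    using assms by (auto simp: frame_pair_def orthonormal_def)
  have "transpose_mat U * V = transpose_mat (transpose_mat V * U)"
    using U V by (simp add: transpose_mult[of _ "k - m" k _ m])
  also have "\<dots> = 0\<^sub>m m (k - m)" using assms by (simp add: frame_pair_def)
  finally have "transpose_mat U * V = 0\<^sub>m m (k - m)" .
  moreover have "V * transpose_mat V + U * transpose_mat U = U * transpose_mat U + V * transpose_mat V"
    using U V by (intro comm_add_mat[of _ k k]) auto
  ultimately show ?thesis using assms by (simp add: frame_pair_def)
qed

lemma sum_lessThan_add:
  fixes f :: "nat \<Rightarrow> 'a :: comm_monoid_add"
  shows "sum f {..<m + n} = sum f {..<m} + (\<Sum>i<n. f (m + i))"
  by (induction n) (simp_all add: add.assoc)

text \<open>\<open>U\<close> is completed to a square orthonormal \<open>Q\<close>, and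
  \<open>V\<close> consists of the remaining columns. Being square, \<open>Q\<close> also satisfies
  \<open>Q * transpose_mat Q = 1\<^sub>m k\<close>, and this product splits into the two
  projections.\<close>

lemma orthonormal_complement:
  assumes U: "orthonormal k m U" and "m \<le> k"
  obtains V where "frame_pair k m U V"
proof -
  have Uc: "U \<in> carrier_mat k m" using U by (rule orthonormal_carrier)
  obtain Q where Q: "orthonormal k k Q" "extends_cols U Q"
    using orthonormal_extend[OF U, of "k - m" "\<lambda>_. 0\<^sub>v k"] \<open>m \<le> k\<close> by auto
  have Qc: "Q \<in> carrier_mat k k" using Q(1) by (rule orthonormal_carrier)
  define V where "V = mat k (k - m) (\<lambda>(i, j). Q $$ (i, m + j))"
  have Vc: "V \<in> carrier_mat k (k - m)" by (simp add: V_def)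
  have QU: "U $$ (i, j) = Q $$ (i, j)" if "i < k" "j < m" for i j
    using Q(2) Uc that by (simp add: extends_cols_def)
  have ent: "(\<Sum>l<k. Q $$ (l, i) * Q $$ (l, j)) = (if i = j then 1 else 0)" if "i < k" "j < k" for i j
    using Q(1) Qc that by (simp add: orthonormal_iff_entries)
  have "orthonormal k (k - m) V"
    using Vc ent by (subst orthonormal_iff_entries) (auto simp: V_def)
  moreover have "transpose_mat V * U = 0\<^sub>m (k - m) m"
  proof (rule eq_matI)
    fix i j assume "i < dim_row (0\<^sub>m (k - m) m :: real mat)" "j < dim_col (0\<^sub>m (k - m) m :: real mat)"
    then have ij: "i < k - m" "j < m" by auto
    then have "(transpose_mat V * U) $$ (i, j) = (\<Sum>l<k. Q $$ (l, m + i) * Q $$ (l, j))"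
      using Uc by (auto simp: V_def scalar_prod_def QU lessThan_atLeast0 intro!: sum.cong)
    then show "(transpose_mat V * U) $$ (i, j) = 0\<^sub>m (k - m) m $$ (i, j)"
      using ij ent[of "m + i" j] by simp
  qed (use Uc Vc in auto)
  moreover have "U * transpose_mat U + V * transpose_mat V = 1\<^sub>m k"
  proof -
    have "Q * transpose_mat Q = 1\<^sub>m k"
      using Q(1) Qc by (intro mat_mult_left_right_inverse[of "transpose_mat Q"]) (auto simp: orthonormal_def)
    moreover have "U * transpose_mat U + V * transpose_mat V = Q * transpose_mat Q"
    proof (rule eq_matI)
      fix i j assume "i < dim_row (Q * transpose_mat Q)" "j < dim_col (Q * transpose_mat Q)"
      then have ij: "i < k" "j < k" using Qc by auto
      have "(Q * transpose_mat Q) $$ (i, j) = (\<Sum>l<m + (k - m). Q $$ (i, l) * Q $$ (j, l))"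
        using Qc ij \<open>m \<le> k\<close> by (simp add: scalar_prod_def lessThan_atLeast0)
      also have "\<dots> = (\<Sum>l<m. Q $$ (i, l) * Q $$ (j, l)) + (\<Sum>l<k - m. Q $$ (i, m + l) * Q $$ (j, m + l))"
        by (rule sum_lessThan_add)
      also have "\<dots> = (U * transpose_mat U + V * transpose_mat V) $$ (i, j)"
        using Uc Vc ij by (simp add: scalar_prod_def lessThan_atLeast0 QU) (simp add: V_def)
      finally show "(U * transpose_mat U + V * transpose_mat V) $$ (i, j) = (Q * transpose_mat Q) $$ (i, j)" ..
    qed (use Uc Vc Qc in auto)
    ultimately show ?thesis by simp
  qed
  ultimately show thesis using that U by (simp add: frame_pair_def)
qed

lemma vec_norm2_orthonormal_mult:
  assumes "orthonormal k m U" "b \<in> carrier_vec m"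
  shows "vec_norm2 (U *\<^sub>v b) = vec_norm2 b"
proof -
  have U: "U \<in> carrier_mat k m" using assms(1) by (rule orthonormal_carrier)
  have "(vec_norm2 (U *\<^sub>v b))\<^sup>2 = (transpose_mat U *\<^sub>v (U *\<^sub>v b)) \<bullet> b"
    using transpose_vec_mult_scalar[OF U assms(2), of "U *\<^sub>v b"] U assms by (simp add: vec_norm2_sq)
  then show ?thesis
    using orthonormal_mult_vec[OF assms] by (simp add: vec_norm2_sq[symmetric] power2_eq_iff_nonneg)
qed

lemma orthonormal_op_bounded: "orthonormal k m U \<Longrightarrow> op_bounded U 1"
  by (intro op_boundedI[OF orthonormal_carrier]) (auto dest: vec_norm2_orthonormal_mult)

text \<open>Pairing \<open>x\<close> with the resolution of the identity applied to \<open>x\<close>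
  gives the two squares.\<close>

lemma frame_pair_pythagoras:
  assumes fp: "frame_pair k m U V" and x: "x \<in> carrier_vec k"
  shows "(vec_norm2 (transpose_mat U *\<^sub>v x))\<^sup>2 + (vec_norm2 (transpose_mat V *\<^sub>v x))\<^sup>2 = (vec_norm2 x)\<^sup>2"
proof -
  have sq: "(vec_norm2 (transpose_mat X *\<^sub>v x))\<^sup>2 = x \<bullet> ((X * transpose_mat X) *\<^sub>v x)"
    if X: "X \<in> carrier_mat k n" for X n
    using transpose_vec_mult_scalar[OF X _ x, of "transpose_mat X *\<^sub>v x"] X x
      assoc_mult_mat_vec[of X k n "transpose_mat X" k x]
    by (simp add: vec_norm2_sq)
  have U: "U \<in> carrier_mat k m" and V: "V \<in> carrier_mat k (k - m)"
    using fp by (auto simp: frame_pair_def orthonormal_def)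
  have "x \<bullet> ((U * transpose_mat U) *\<^sub>v x) + x \<bullet> ((V * transpose_mat V) *\<^sub>v x)
      = x \<bullet> ((U * transpose_mat U + V * transpose_mat V) *\<^sub>v x)"
    using U V x by (subst add_mult_distrib_mat_vec[of _ k k]) (auto simp: scalar_prod_add_distrib[of _ k])
  also have "\<dots> = x \<bullet> x" using fp x by (simp add: frame_pair_def)
  finally show ?thesis using sq[OF U] sq[OF V] by (simp add: vec_norm2_sq)
qed

lemma mat_inverse_exists:
  fixes M :: "'a :: field mat"
  assumes M: "M \<in> carrier_mat n n" and inj: "\<And>v. v \<in> carrier_vec n \<Longrightarrow> M *\<^sub>v v = 0\<^sub>v n \<Longrightarrow> v = 0\<^sub>v n"
  obtains N where "N \<in> carrier_mat n n" "N * M = 1\<^sub>m n" "M * N = 1\<^sub>m n"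
proof -
  have "det M \<noteq> 0" using det_0_iff_vec_prod_zero_field[OF M] inj by blast
  from det_non_zero_imp_unit[OF M this, of "()"] show thesis
    using that by (auto simp: Units_def ring_mat_simps)
qed

section \<open>Graph charts for low-rank matrices\<close>

text \<open>For the components \<open>M\<close> and \<open>E\<close> of \<open>U\<close> along
  \<open>U\<^sub>0\<close> and \<open>V\<^sub>0\<close>, |Ma|^2 + |Ea|^2 = |a|^2, and
  \<open>E\<close> is small. So \<open>M\<close> is injective, hence has an inverse
  \<open>N\<close>, and \<open>T = E * N\<close> is the contraction whose graph is the range of
  \<open>U\<close>. Then \<open>transpose_mat V\<^sub>0 * W = T * (transpose_mat U\<^sub>0 *
  W)\<close>, and the resolution of the identity rebuilds \<open>W\<close>.\<close>

lemma low_rank_chart: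
  assumes fp: "frame_pair k r U\<^sub>0 V\<^sub>0" and U: "orthonormal k r U"
    and near: "op_bounded (transpose_mat V\<^sub>0 * U) (1/4)"
    and W: "W \<in> carrier_mat k d" "U * (transpose_mat U * W) = W"
  obtains T where "T \<in> carrier_mat (k - r) r" "op_bounded T 1"
    "W = U\<^sub>0 * (transpose_mat U\<^sub>0 * W) + V\<^sub>0 * (T * (transpose_mat U\<^sub>0 * W))"
proof -
  have U0: "U\<^sub>0 \<in> carrier_mat k r" and V0: "V\<^sub>0 \<in> carrier_mat k (k - r)"
    using fp by (auto simp: frame_pair_def orthonormal_def)
  have Uc: "U \<in> carrier_mat k r" using U by (rule orthonormal_carrier)
  define M where "M = transpose_mat U\<^sub>0 * U"
  define E where "E = transpose_mat V\<^sub>0 * U"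
  define X where "X = transpose_mat U * W"
  have M: "M \<in> carrier_mat r r" and E: "E \<in> carrier_mat (k - r) r" and X: "X \<in> carrier_mat r d"
    using U0 V0 Uc W by (auto simp: M_def E_def X_def)
  have sq: "(vec_norm2 (M *\<^sub>v a))\<^sup>2 + (vec_norm2 (E *\<^sub>v a))\<^sup>2 = (vec_norm2 a)\<^sup>2"
    if a: "a \<in> carrier_vec r" for a
  proof -
    have "M *\<^sub>v a = transpose_mat U\<^sub>0 *\<^sub>v (U *\<^sub>v a)" "E *\<^sub>v a = transpose_mat V\<^sub>0 *\<^sub>v (U *\<^sub>v a)"
      using U0 V0 Uc a unfolding M_def E_def by (auto intro!: assoc_mult_mat_vec)
    moreover have "U *\<^sub>v a \<in> carrier_vec k" using Uc a by auto
    ultimately show ?thesis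
      using frame_pair_pythagoras[OF fp, of "U *\<^sub>v a"] vec_norm2_orthonormal_mult[OF U a] by simp
  qed
  have Esq: "(vec_norm2 (E *\<^sub>v a))\<^sup>2 \<le> (vec_norm2 a)\<^sup>2 / 16" if a: "a \<in> carrier_vec r" for a
    using power_mono[OF op_boundedD[OF near[folded E_def] E a] vec_norm2_nonneg, of 2]
    by (simp add: power_divide)
  have "v = 0\<^sub>v r" if v: "v \<in> carrier_vec r" "M *\<^sub>v v = 0\<^sub>v r" for v
  proof -
    have "(vec_norm2 v)\<^sup>2 \<le> 0" using sq[OF v(1)] Esq[OF v(1)] v(2) by simp
    then show ?thesis using vec_norm2_eq_0[OF v(1)] by simp
  qed
  then obtain N where N: "N \<in> carrier_mat r r" "N * M = 1\<^sub>m r" "M * N = 1\<^sub>m r"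
    using mat_inverse_exists[OF M] by blast
  have "op_bounded (E * N) 1"
  proof (rule op_boundedI[of _ "k - r" r])
    fix y :: "real vec" assume y: "y \<in> carrier_vec r"
    define a where "a = N *\<^sub>v y"
    have a: "a \<in> carrier_vec r" using N y by (simp add: a_def)
    have "(E * N) *\<^sub>v y = E *\<^sub>v a" using E N y unfolding a_def by (intro assoc_mult_mat_vec)
    moreover have "M *\<^sub>v a = y"
      using assoc_mult_mat_vec[OF M N(1) y] N y by (simp add: a_def)
    \<comment> \<open>By \<open>sq\<close> and \<open>Esq\<close>, |Ma|^2 is at least 15/16 |a|^2,
      while |Ea|^2 is at most 1/16 |a|^2.\<close>
    moreover have "(vec_norm2 (E *\<^sub>v a))\<^sup>2 \<le> (vec_norm2 (M *\<^sub>v a))\<^sup>2"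
      using sq[OF a] Esq[OF a] zero_le_power2[of "vec_norm2 (M *\<^sub>v a)"] by linarith
    ultimately show "vec_norm2 ((E * N) *\<^sub>v y) \<le> 1 * vec_norm2 y" by (auto dest: power2_le_imp_le)
  qed (use E N in auto)
  moreover have "W = U\<^sub>0 * (transpose_mat U\<^sub>0 * W) + V\<^sub>0 * (E * N * (transpose_mat U\<^sub>0 * W))"
  proof -
    have WX: "W = U * X" using W by (simp add: X_def)
    have "transpose_mat U\<^sub>0 * W = M * X"
      unfolding M_def WX using U0 Uc X by (intro assoc_mult_mat[symmetric]) auto
    then have "E * N * (transpose_mat U\<^sub>0 * W) = E * (N * (M * X))"
      using assoc_mult_mat[OF E N(1) mult_carrier_mat[OF M X]] by simp
    also have "N * (M * X) = X" using assoc_mult_mat[OF N(1) M X] N X by simp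
    also have "E * X = transpose_mat V\<^sub>0 * W"
      unfolding E_def WX using V0 Uc X by (intro assoc_mult_mat) auto
    finally have "U\<^sub>0 * (transpose_mat U\<^sub>0 * W) + V\<^sub>0 * (E * N * (transpose_mat U\<^sub>0 * W))
        = U\<^sub>0 * (transpose_mat U\<^sub>0 * W) + V\<^sub>0 * (transpose_mat V\<^sub>0 * W)" by simp
    also have "\<dots> = (U\<^sub>0 * transpose_mat U\<^sub>0) * W + (V\<^sub>0 * transpose_mat V\<^sub>0) * W"
      using assoc_mult_mat[of U\<^sub>0 k r "transpose_mat U\<^sub>0" k W d]
        assoc_mult_mat[of V\<^sub>0 k "k - r" "transpose_mat V\<^sub>0" k W d] U0 V0 W by simp
    also have "\<dots> = (U\<^sub>0 * transpose_mat U\<^sub>0 + V\<^sub>0 * transpose_mat V\<^sub>0) * W"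
      using U0 V0 W by (intro add_mult_distrib_mat[symmetric, of _ k k]) auto
    also have "\<dots> = W" using fp W by (simp add: frame_pair_def)
    finally show ?thesis ..
  qed
  ultimately show thesis using that E N by (metis mult_carrier_mat)
qed

text \<open>A net of the \<open>k \<times> r\<close> frames themselves has size \<open>36 ^ (k * r)\<close>, which is too large if \<open>r\<close>
  is close to \<open>k\<close>; in that case the complementary \<open>k \<times> (k - r)\<close> frames are discretised instead.\<close>

lemma coarse_net:
  assumes "r \<le> k"
  obtains Q where "finite Q" "\<And>U\<^sub>0 V\<^sub>0. (U\<^sub>0, V\<^sub>0) \<in> Q \<Longrightarrow> frame_pair k r U\<^sub>0 V\<^sub>0"
    "real (card Q) \<le> 36 ^ (2 * r * (k - r))"
    "\<And>U. orthonormal k r U \<Longrightarrow> \<exists>(U\<^sub>0, V\<^sub>0)\<in>Q. op_bounded (transpose_mat V\<^sub>0 * U) (1/4)"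
proof -
  \<comment> \<open>The base is \<open>36 = 9 / (1/4)\<close>, for nets of mesh 1/4;
    \<open>m\<close> is left free because both \<open>r\<close> and \<open>k - r\<close>
    occur.\<close>
  have "\<exists>P. finite P \<and> P \<subseteq> {U. orthonormal k m U} \<and> real (card P) \<le> 36 ^ (k * m) \<and>
      (\<forall>U. orthonormal k m U \<longrightarrow> (\<exists>U\<^sub>0\<in>P. op_bounded (U - U\<^sub>0) (1/4)))" for m
    by (rule mat_covering[of "{U. orthonormal k m U}" k m "1/4"])
      (auto simp: orthonormal_carrier orthonormal_op_bounded)
  then obtain P where P: "finite (P m)" "\<And>U. U \<in> P m \<Longrightarrow> orthonormal k m U" "real (card (P m)) \<le> 36 ^ (k * m)"
    "\<And>U. orthonormal k m U \<Longrightarrow> \<exists>U\<^sub>0\<in>P m. op_bounded (U - U\<^sub>0) (1/4)" for m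
    by (metis mem_Collect_eq subsetD)
  show thesis
  \<comment> \<open>The narrower of the two frames is discretised. The wider one then has at least
    half of the \<open>k\<close> columns, so \<open>k * r\<close>, respectively
    \<open>k * (k - r)\<close>, is at most \<open>2 * r * (k - r)\<close>.\<close>
  proof (cases "2 * r \<le> k")
    case True
    define compl where "compl U = (SOME V. frame_pair k r U V)" for U
    have compl: "frame_pair k r U (compl U)" if "orthonormal k r U" for U
      unfolding compl_def by (rule someI_ex) (use orthonormal_complement[OF that assms] in blast)
    show thesis
    proof (rule that[of "(\<lambda>U\<^sub>0. (U\<^sub>0, compl U\<^sub>0)) ` P r"])
      have "real (card ((\<lambda>U\<^sub>0. (U\<^sub>0, compl U\<^sub>0)) ` P r)) \<le> 36 ^ (k * r)"
        using card_image_le[OF P(1)[of r], of "\<lambda>U\<^sub>0. (U\<^sub>0, compl U\<^sub>0)"] P(3)[of r] by linarith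
      also have "(36 :: real) ^ (k * r) \<le> 36 ^ (2 * r * (k - r))"
      proof (rule power_increasing)
        have "k * r \<le> (2 * (k - r)) * r" using True by (intro mult_le_mono1) linarith
        then show "k * r \<le> 2 * r * (k - r)" by (simp add: ac_simps)
      qed simp
      finally show "real (card ((\<lambda>U\<^sub>0. (U\<^sub>0, compl U\<^sub>0)) ` P r)) \<le> 36 ^ (2 * r * (k - r))" .
    next
      fix U assume U: "orthonormal k r U"
      obtain U\<^sub>0 where U0: "U\<^sub>0 \<in> P r" "op_bounded (U - U\<^sub>0) (1/4)" using P(4)[OF U] by blast
      then have o: "orthonormal k r U\<^sub>0" using P(2) by blast
      let ?V = "compl U\<^sub>0"
      have fp: "frame_pair k r U\<^sub>0 ?V" by (rule compl[OF o])
      have V: "?V \<in> carrier_mat k (k - r)" and oV: "orthonormal k (k - r) ?V"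
        using fp by (auto simp: frame_pair_def orthonormal_def)
      \<comment> \<open>As \<open>?V\<close> is orthogonal to \<open>U\<^sub>0\<close>, subtracting
        \<open>U\<^sub>0\<close> leaves the product unchanged and exposes the small
        difference.\<close>
      have "transpose_mat ?V * (U - U\<^sub>0) = transpose_mat ?V * U - transpose_mat ?V * U\<^sub>0"
        using V orthonormal_carrier[OF U] orthonormal_carrier[OF o]
        by (intro mult_minus_distrib_mat[of _ "k - r" k]) auto
      also have "\<dots> = transpose_mat ?V * U"
        using fp V orthonormal_carrier[OF U] by (auto simp: frame_pair_def)
      finally have "transpose_mat ?V * (U - U\<^sub>0) = transpose_mat ?V * U" .
      moreover have "op_bounded (transpose_mat ?V * (U - U\<^sub>0)) (1 * (1/4))"
        using V orthonormal_carrier[OF o] U0(2)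
        by (intro op_bounded_mult[of _ _ _ _ "k - r" k r] op_bounded_transpose[OF orthonormal_op_bounded[OF oV] V]) auto
      ultimately show "\<exists>(U\<^sub>0, V\<^sub>0)\<in>(\<lambda>U\<^sub>0. (U\<^sub>0, compl U\<^sub>0)) ` P r. op_bounded (transpose_mat V\<^sub>0 * U) (1/4)"
        using U0(1) by auto
    qed (use P compl in auto)
  next
    case False
    let ?s = "k - r"
    have k: "k - ?s = r" using assms by simp
    define compl where "compl V = (SOME U. frame_pair k r U V)" for V
    have ex: "\<exists>U. frame_pair k r U V" if V: "orthonormal k ?s V" for V
    proof -
      obtain U where "frame_pair k ?s V U" using orthonormal_complement[OF V] by auto
      from frame_pair_commute[OF this] show ?thesis using k by auto
    qed
    have compl: "frame_pair k r (compl V) V" if "orthonormal k ?s V" for V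
      unfolding compl_def by (rule someI_ex[OF ex[OF that]])
    show thesis
    proof (rule that[of "(\<lambda>V\<^sub>0. (compl V\<^sub>0, V\<^sub>0)) ` P ?s"])
      have "real (card ((\<lambda>V\<^sub>0. (compl V\<^sub>0, V\<^sub>0)) ` P ?s)) \<le> 36 ^ (k * ?s)"
        using card_image_le[OF P(1)[of ?s], of "\<lambda>V\<^sub>0. (compl V\<^sub>0, V\<^sub>0)"] P(3)[of ?s] by linarith
      also have "(36 :: real) ^ (k * ?s) \<le> 36 ^ (2 * r * (k - r))"
        using False by (intro power_increasing mult_le_mono1) auto
      finally show "real (card ((\<lambda>V\<^sub>0. (compl V\<^sub>0, V\<^sub>0)) ` P ?s)) \<le> 36 ^ (2 * r * (k - r))" .
    next
      fix U assume U: "orthonormal k r U"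
      obtain V where fp: "frame_pair k r U V" using orthonormal_complement[OF U assms] .
      then have oV: "orthonormal k ?s V" by (simp add: frame_pair_def)
      obtain V\<^sub>0 where V0: "V\<^sub>0 \<in> P ?s" "op_bounded (V - V\<^sub>0) (1/4)" using P(4)[OF oV] by blast
      then have o: "orthonormal k ?s V\<^sub>0" using P(2) by blast
      have c: "V \<in> carrier_mat k ?s" "V\<^sub>0 \<in> carrier_mat k ?s" "U \<in> carrier_mat k r"
        using oV o U by (auto intro: orthonormal_carrier)
      \<comment> \<open>Here the complement \<open>V\<close> of \<open>U\<close> is close to
        \<open>V\<^sub>0\<close>; since \<open>V\<close> is orthogonal to \<open>U\<close>, the
        product with \<open>V\<^sub>0\<close> equals, up to sign, the product with the small
        difference.\<close>
      have "transpose_mat (V - V\<^sub>0) * U = transpose_mat V * U - transpose_mat V\<^sub>0 * U"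
        using c by (simp add: transpose_minus minus_mult_distrib_mat[of _ ?s k])
      also have "\<dots> = (-1) \<cdot>\<^sub>m (transpose_mat V\<^sub>0 * U)"
        using fp c by (intro eq_matI) (auto simp: frame_pair_def)
      finally have "transpose_mat V\<^sub>0 * U = (-1) \<cdot>\<^sub>m (transpose_mat (V - V\<^sub>0) * U)"
        using c by (intro eq_matI) auto
      moreover have "op_bounded (transpose_mat (V - V\<^sub>0) * U) (1/4 * 1)"
        using c by (intro op_bounded_mult[of _ _ _ _ ?s k r] op_bounded_transpose[OF V0(2)]
            orthonormal_op_bounded[OF U]) auto
      moreover have "transpose_mat (V - V\<^sub>0) * U \<in> carrier_mat ?s r"
        using c by (intro mult_carrier_mat[of _ _ k]) (auto intro: minus_carrier_mat)
      ultimately have "op_bounded (transpose_mat V\<^sub>0 * U) (1/4)"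
        using op_bounded_smult[of "transpose_mat (V - V\<^sub>0) * U" "1/4" ?s r "-1"] by simp
      then show "\<exists>(U\<^sub>0, V\<^sub>0)\<in>(\<lambda>V\<^sub>0. (compl V\<^sub>0, V\<^sub>0)) ` P ?s. op_bounded (transpose_mat V\<^sub>0 * U) (1/4)"
        using V0(1) by auto
    qed (use P compl in auto)
  qed
qed

section \<open>Covering low-rank matrices\<close>

text \<open>Each chart is discretised by nets for \<open>T\<close> and for \<open>A\<close> divided
  by \<open>B\<close>; the exponents \<open>(k - r) * r\<close> and \<open>r * d\<close> add up to
  the dimension of the manifold. The error splits into three terms of norm at most
  \<open>B * \<delta>\<close>, whence the factor 3.\<close>

lemma low_rank_covering:
  assumes "r \<le> k" and B: "B > 0" and \<delta>: "0 < \<delta>" "\<delta> \<le> 1"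
  obtains N where "finite N" "N \<subseteq> carrier_mat k d"
    "real (card N) \<le> 36 ^ (2 * r * (k - r)) * (9 / \<delta>) ^ (r * (d + (k - r)))"
    "\<And>W. W \<in> low_rank_mats k d r B \<Longrightarrow> \<exists>W'\<in>N. op_bounded (W - W') (3 * B * \<delta>)"
proof -
  obtain Q where Q: "finite Q" "\<And>U\<^sub>0 V\<^sub>0. (U\<^sub>0, V\<^sub>0) \<in> Q \<Longrightarrow> frame_pair k r U\<^sub>0 V\<^sub>0"
    "real (card Q) \<le> 36 ^ (2 * r * (k - r))"
    "\<And>U. orthonormal k r U \<Longrightarrow> \<exists>(U\<^sub>0, V\<^sub>0)\<in>Q. op_bounded (transpose_mat V\<^sub>0 * U) (1/4)"
    using coarse_net[OF \<open>r \<le> k\<close>] by blast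
  have net: "\<exists>P. finite P \<and> P \<subseteq> {X \<in> carrier_mat a b. op_bounded X 1} \<and>
      real (card P) \<le> (9 / \<delta>) ^ (a * b) \<and>
      (\<forall>X\<in>{X \<in> carrier_mat a b. op_bounded X 1}. \<exists>Y\<in>P. op_bounded (X - Y) \<delta>)" for a b
    by (rule mat_covering[OF _ _ \<delta>, of "{X \<in> carrier_mat a b. op_bounded X 1}" a b]) auto
  obtain PT where PT: "finite PT" "PT \<subseteq> {X \<in> carrier_mat (k - r) r. op_bounded X 1}"
    "real (card PT) \<le> (9 / \<delta>) ^ ((k - r) * r)"
    "\<And>X. X \<in> carrier_mat (k - r) r \<Longrightarrow> op_bounded X 1 \<Longrightarrow> \<exists>Y\<in>PT. op_bounded (X - Y) \<delta>"
    using net[of "k - r" r] by blast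
  obtain PA where PA: "finite PA" "PA \<subseteq> {X \<in> carrier_mat r d. op_bounded X 1}"
    "real (card PA) \<le> (9 / \<delta>) ^ (r * d)"
    "\<And>X. X \<in> carrier_mat r d \<Longrightarrow> op_bounded X 1 \<Longrightarrow> \<exists>Y\<in>PA. op_bounded (X - Y) \<delta>"
    using net[of r d] by blast
  define F where "F = (\<lambda>((U\<^sub>0, V\<^sub>0), T, A). U\<^sub>0 * (B \<cdot>\<^sub>m A) + V\<^sub>0 * (T * (B \<cdot>\<^sub>m A)))"
  show thesis
  proof
    show "finite (F ` (Q \<times> PT \<times> PA))" using Q PT PA by simp
    show "F ` (Q \<times> PT \<times> PA) \<subseteq> carrier_mat k d"
    proof clarify
      fix U\<^sub>0 V\<^sub>0 T A assume *: "(U\<^sub>0, V\<^sub>0) \<in> Q" "T \<in> PT" "A \<in> PA"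
      have "U\<^sub>0 \<in> carrier_mat k r" "V\<^sub>0 \<in> carrier_mat k (k - r)"
        using Q(2)[OF *(1)] by (auto simp: frame_pair_def orthonormal_carrier)
      moreover have "T \<in> carrier_mat (k - r) r" "A \<in> carrier_mat r d" using * PT(2) PA(2) by auto
      ultimately show "F ((U\<^sub>0, V\<^sub>0), T, A) \<in> carrier_mat k d"
        unfolding F_def prod.case by (intro add_carrier_mat mult_carrier_mat) auto
    qed
    have "card (F ` (Q \<times> PT \<times> PA)) \<le> card Q * (card PT * card PA)"
      using card_image_le[of "Q \<times> PT \<times> PA" F] Q PT PA by (simp add: card_cartesian_product)
    then have "real (card (F ` (Q \<times> PT \<times> PA))) \<le> real (card Q) * (real (card PT) * real (card PA))"
      by (simp flip: of_nat_mult)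
    also have "\<dots> \<le> 36 ^ (2 * r * (k - r)) * ((9 / \<delta>) ^ ((k - r) * r) * (9 / \<delta>) ^ (r * d))"
      using Q(3) PT(3) PA(3) \<delta> by (intro mult_mono) auto
    also have "(9 / \<delta>) ^ ((k - r) * r) * (9 / \<delta>) ^ (r * d) = (9 / \<delta>) ^ (r * (d + (k - r)))"
      unfolding power_add[symmetric] by (rule arg_cong[of _ _ "power (9 / \<delta>)"]) (simp add: distrib_left)
    finally show "real (card (F ` (Q \<times> PT \<times> PA)))
        \<le> 36 ^ (2 * r * (k - r)) * (9 / \<delta>) ^ (r * (d + (k - r)))" .
  next
    fix W assume "W \<in> low_rank_mats k d r B"
    then have W: "W \<in> carrier_mat k d" "vec_space.rank k W \<le> r" and WB: "op_bounded W B"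
      using op_bounded_mono[OF op_bounded_opnorm] by (auto simp: low_rank_mats_def)
    obtain U where U: "orthonormal k r U" "U * (transpose_mat U * W) = W"
      using low_rank_orthonormal[OF W \<open>r \<le> k\<close>] .
    obtain U\<^sub>0 V\<^sub>0 where UV: "(U\<^sub>0, V\<^sub>0) \<in> Q" "op_bounded (transpose_mat V\<^sub>0 * U) (1/4)"
      using Q(4)[OF U(1)] by auto
    have fp: "frame_pair k r U\<^sub>0 V\<^sub>0" using Q(2) UV(1) .
    then have o: "orthonormal k r U\<^sub>0" "orthonormal k (k - r) V\<^sub>0" by (auto simp: frame_pair_def)
    then have U0: "U\<^sub>0 \<in> carrier_mat k r" and V0: "V\<^sub>0 \<in> carrier_mat k (k - r)"
      by (auto intro: orthonormal_carrier)
    define A where "A = transpose_mat U\<^sub>0 * W"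
    obtain T where T: "T \<in> carrier_mat (k - r) r" "op_bounded T 1" "W = U\<^sub>0 * A + V\<^sub>0 * (T * A)"
      using low_rank_chart[OF fp U(1) UV(2) W(1) U(2)] unfolding A_def .
    have A: "A \<in> carrier_mat r d" using U0 W by (simp add: A_def)
    have AB: "op_bounded A (1 * B)" unfolding A_def
      using U0 W(1) WB op_bounded_transpose[OF orthonormal_op_bounded[OF o(1)] U0]
      by (intro op_bounded_mult[of _ _ _ _ r k d]) auto
    have "op_bounded (inverse B \<cdot>\<^sub>m A) 1"
      using op_bounded_smult[OF AB A, of "inverse B"] B by simp
    then obtain A' where A': "A' \<in> PA" "op_bounded (inverse B \<cdot>\<^sub>m A - A') \<delta>"
      using PA(4)[of "inverse B \<cdot>\<^sub>m A"] A by auto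
    obtain T' where T': "T' \<in> PT" "op_bounded (T - T') \<delta>" using PT(4)[OF T(1,2)] by blast
    have A'c: "A' \<in> carrier_mat r d" "op_bounded A' 1" and T'c: "T' \<in> carrier_mat (k - r) r"
      using A'(1) T'(1) PA(2) PT(2) by auto
    define A'' where "A'' = B \<cdot>\<^sub>m A'"
    have A'': "A'' \<in> carrier_mat r d" using A'c by (simp add: A''_def)
    have "A - A'' = B \<cdot>\<^sub>m (inverse B \<cdot>\<^sub>m A - A')"
      using A A'c B by (intro eq_matI) (auto simp: A''_def field_simps)
    moreover have "inverse B \<cdot>\<^sub>m A - A' \<in> carrier_mat r d"
      using A'c by (intro minus_carrier_mat)
    ultimately have dA: "op_bounded (A - A'') (B * \<delta>)"
      using op_bounded_smult[OF A'(2), of r d B] B by simp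
    have bA'': "op_bounded A'' B"
      using op_bounded_smult[OF A'c(2,1), of B] B by (simp add: A''_def)
    have dAc: "A - A'' \<in> carrier_mat r d" and dTc: "T - T' \<in> carrier_mat (k - r) r"
      using A'' T'c by (auto intro: minus_carrier_mat)
    \<comment> \<open>The change of \<open>T * A\<close> is telescoped, so that each product has one
      small factor and one bounded factor.\<close>
    let ?D = "T * (A - A'') + (T - T') * A''"
    have D: "?D \<in> carrier_mat (k - r) d"
      using dTc A'' by (intro add_carrier_mat mult_carrier_mat)
    have "op_bounded ?D (1 * (B * \<delta>) + \<delta> * B)"
      using \<delta>(1) T(1) dAc dTc A''
      by (intro op_bounded_add[OF op_bounded_mult[OF T(2) dA T(1) dAc]
            op_bounded_mult[OF T'(2) bA'' dTc A'']] mult_carrier_mat) simp_all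
    from op_bounded_mult[OF orthonormal_op_bounded[OF o(2)] this V0 D]
    have "op_bounded (U\<^sub>0 * (A - A'') + V\<^sub>0 * ?D) (1 * (B * \<delta>) + 1 * (1 * (B * \<delta>) + \<delta> * B))"
      using U0 V0 dAc D
      by (intro op_bounded_add[OF op_bounded_mult[OF orthonormal_op_bounded[OF o(1)] dA U0 dAc]]
          mult_carrier_mat) simp_all
    moreover have "U\<^sub>0 * (A - A'') + V\<^sub>0 * ?D
        = W - (U\<^sub>0 * A'' + V\<^sub>0 * (T' * A''))"
    proof -
      have c: "U\<^sub>0 * A \<in> carrier_mat k d" "U\<^sub>0 * A'' \<in> carrier_mat k d" "T * A \<in> carrier_mat (k - r) d"
        "T * A'' \<in> carrier_mat (k - r) d" "T' * A'' \<in> carrier_mat (k - r) d"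
        "V\<^sub>0 * (T * A) \<in> carrier_mat k d" "V\<^sub>0 * (T' * A'') \<in> carrier_mat k d"
        using U0 V0 A A'' T T'c by auto
      have "?D = T * A - T' * A''"
        using c T T'c A A''
        by (simp add: mult_minus_distrib_mat[of _ "k - r" r] minus_mult_distrib_mat[of _ "k - r" r])
          (intro eq_matI; auto)
      moreover have "V\<^sub>0 * (T * A - T' * A'') = V\<^sub>0 * (T * A) - V\<^sub>0 * (T' * A'')"
        using V0 c by (intro mult_minus_distrib_mat)
      moreover have "U\<^sub>0 * (A - A'') = U\<^sub>0 * A - U\<^sub>0 * A''"
        using U0 A A'' by (intro mult_minus_distrib_mat)
      moreover have "(U\<^sub>0 * A - U\<^sub>0 * A'') + (V\<^sub>0 * (T * A) - V\<^sub>0 * (T' * A''))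
          = (U\<^sub>0 * A + V\<^sub>0 * (T * A)) - (U\<^sub>0 * A'' + V\<^sub>0 * (T' * A''))"
        using carrier_matD[OF c(1)] carrier_matD[OF c(2)] carrier_matD[OF c(6)] carrier_matD[OF c(7)]
        by (intro eq_matI) (auto simp del: index_mult_mat(1))
      ultimately show ?thesis using T(3) by simp
    qed
    ultimately have "op_bounded (W - F ((U\<^sub>0, V\<^sub>0), T', A')) (3 * B * \<delta>)"
      by (simp add: F_def A''_def algebra_simps)
    then show "\<exists>W'\<in>F ` (Q \<times> PT \<times> PA). op_bounded (W - W') (3 * B * \<delta>)"
      using UV(1) T'(1) A'(1) by blast
  qed
qed

section \<open>From nets of matrices to covering numbers\<close>

text \<open>One estimate in operator norm serves all inputs of norm at most \<open>b\<close> at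
  once, so the number of centres does not depend on \<open>n\<close>.\<close>

lemma covering_number_linear_le:
  assumes N: "finite N" "N \<subseteq> carrier_mat k d"
    and cover: "\<And>W. W \<in> low_rank_mats k d r B \<Longrightarrow> \<exists>W'\<in>N. op_bounded (W - W') c"
    and x: "\<And>i. i \<in> {1..n} \<Longrightarrow> x i \<in> carrier_vec d \<and> vec_norm2 (x i) \<le> b" and "0 \<le> c"
  shows "covering_number k d (linear_class k d r B) (c * b) n x \<le> enat (card N)"
proof -
  obtain f where f: "bij_betw f {1..card N} N" using ex_bij_betw_nat_finite_1[OF N(1)] by blast
  define g where "g j v = f j *\<^sub>v v" for j and v :: "real vec"
  have "g j \<in> carrier_vec d \<rightarrow> carrier_vec k" if "j \<in> {1..card N}" for j
  proof -
    have "f j \<in> carrier_mat k d" using bij_betwE[OF f] N(2) that by blast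
    then show ?thesis by (auto simp: g_def)
  qed
  moreover have "\<exists>j\<in>{1..card N}. \<forall>i\<in>{1..n}. vec_norm2 (h (x i) - g j (x i)) \<le> c * b"
    if h: "h \<in> linear_class k d r B" for h
  proof -
    obtain W where W: "W \<in> low_rank_mats k d r B" "h = (\<lambda>x. W *\<^sub>v x)"
      using h by (auto simp: linear_class_def)
    obtain W' where W': "W' \<in> N" "op_bounded (W - W') c" using cover[OF W(1)] by blast
    have "W' \<in> f ` {1..card N}" using bij_betw_imp_surj_on[OF f] W'(1) by simp
    then obtain j where j: "j \<in> {1..card N}" "f j = W'" by (elim imageE) simp
    have Wc: "W \<in> carrier_mat k d" "W' \<in> carrier_mat k d" using W W' N by (auto simp: low_rank_mats_def)
    have "vec_norm2 (h (x i) - g j (x i)) \<le> c * b" if i: "i \<in> {1..n}" for i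
    proof -
      have "h (x i) - g j (x i) = (W - W') *\<^sub>v x i"
        using Wc x[OF i] j W(2) by (simp add: g_def minus_mult_distrib_mat_vec[of _ k d])
      then have "vec_norm2 (h (x i) - g j (x i)) \<le> c * vec_norm2 (x i)"
        using op_boundedD[OF W'(2) minus_carrier_mat[OF Wc(2)], of "x i"] x[OF i] by simp
      also have "\<dots> \<le> c * b" using x[OF i] \<open>0 \<le> c\<close> by (intro mult_left_mono) auto
      finally show ?thesis .
    qed
    then show ?thesis using j(1) by blast
  qed
  ultimately show ?thesis unfolding covering_number_def by (intro Inf_lower) blast
qed

text \<open>Finiteness of the covering number is part of the claim, since the logarithm is taken of
  a natural number.\<close>

theorem theorem8:
  shows "\<exists>C::real. C > 0 \<and>
    (\<forall>(k::nat) (d::nat) (n::nat) (r::nat) (B_w::real) (B_x::real) (\<epsilon>::real).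
       k \<ge> 1 \<longrightarrow> d \<ge> 1 \<longrightarrow> n \<ge> 1 \<longrightarrow> 1 \<le> r \<longrightarrow> r \<le> min d k \<longrightarrow> B_w > 0 \<longrightarrow> B_x > 0 \<longrightarrow>
       0 < \<epsilon> \<longrightarrow> \<epsilon> \<le> B_x * B_w \<longrightarrow>
       (\<exists>N::nat. uniform_covering_number k d (linear_class k d r B_w) \<epsilon> n B_x = enat N \<and>
          ln (real N) \<le> real r * (real d + real k - real r) * ln (C * B_x * B_w / \<epsilon>)))"
\<comment> \<open>In the constant, \<open>36\<^sup>2\<close> absorbs the number of charts, and
  \<open>27 = 9 * 3\<close> comes from \<open>9 / \<delta>\<close> with the \<open>\<delta>\<close>
  chosen below.\<close>
proof (intro exI[of _ "36\<^sup>2 * 27 :: real"] conjI allI impI)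
  fix k d n r :: nat and B_w B_x \<epsilon> :: real
  assume r: "r \<le> min d k" and B: "B_w > 0" "B_x > 0" and \<epsilon>: "0 < \<epsilon>" "\<epsilon> \<le> B_x * B_w"
  let ?u = "uniform_covering_number k d (linear_class k d r B_w) \<epsilon> n B_x"
  \<comment> \<open>The net error \<open>3 * B_w * \<delta>\<close>, multiplied by the input bound
    \<open>B_x\<close>, is then exactly \<open>\<epsilon>\<close>; the hypothesis on
    \<open>\<epsilon>\<close> gives \<open>\<delta> \<le> 1\<close>.\<close>
  define \<delta> where "\<delta> = \<epsilon> / (3 * B_x * B_w)"
  have BB: "B_x * B_w > 0" using B by simp
  have \<delta>: "0 < \<delta>" "\<delta> \<le> 1" using B \<epsilon> BB by (auto simp: \<delta>_def divide_le_eq)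
  obtain N where N: "finite N" "N \<subseteq> carrier_mat k d"
    "real (card N) \<le> 36 ^ (2 * r * (k - r)) * (9 / \<delta>) ^ (r * (d + (k - r)))"
    "\<And>W. W \<in> low_rank_mats k d r B_w \<Longrightarrow> \<exists>W'\<in>N. op_bounded (W - W') (3 * B_w * \<delta>)"
    using low_rank_covering[of r k B_w \<delta> d] r B(1) \<delta> by auto
  have "3 * B_w * \<delta> * B_x = \<epsilon>" using B by (simp add: \<delta>_def)
  then have "covering_number k d (linear_class k d r B_w) \<epsilon> n x \<le> enat (card N)"
    if "\<forall>i\<in>{1..n}. x i \<in> carrier_vec d \<and> vec_norm2 (x i) \<le> B_x" for x
    using covering_number_linear_le[OF N(1,2,4), where n = n and x = x and b = B_x] that B \<delta> by auto
  then have "?u \<le> enat (card N)" unfolding uniform_covering_number_def by (intro SUP_least) auto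
  then obtain m where m: "?u = enat m" "m \<le> card N" by (cases ?u) auto
  let ?q = "36\<^sup>2 * 27 * B_x * B_w / \<epsilon>"
  have q: "?q = 36\<^sup>2 * (9 / \<delta>)" using B \<epsilon> by (simp add: \<delta>_def)
  have q1: "1 \<le> ?q" using \<epsilon> by (simp add: le_divide_eq)
  have dim: "real (r * (d + (k - r))) = real r * (real d + real k - real r)"
    using r by (simp add: of_nat_diff)
  have "ln (real m) \<le> real (r * (d + (k - r))) * ln ?q"
  \<comment> \<open>By convention \<open>ln 0\<close> is 0, and the right-hand side is nonnegative
    because \<open>1 \<le> ?q\<close>.\<close>
  proof (cases "m = 0")
    case True
    then show ?thesis using q1 by (simp add: ln_ge_zero)
  next
    case False
    have "real m \<le> real (card N)" using m by simp
    also have "\<dots> \<le> 36 ^ (2 * r * (k - r)) * (9 / \<delta>) ^ (r * (d + (k - r)))" by (rule N(3))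
    \<comment> \<open>In the chart exponent \<open>k - r\<close> is enlarged to
      \<open>d + (k - r)\<close>, so that both factors merge into one power of
      \<open>?q\<close>.\<close>
    also have "\<dots> \<le> 36 ^ (2 * (r * (d + (k - r)))) * (9 / \<delta>) ^ (r * (d + (k - r)))"
    proof (intro mult_right_mono power_increasing)
      have "2 * r * (k - r) \<le> 2 * r * (d + (k - r))" by (rule mult_le_mono2) simp
      then show "2 * r * (k - r) \<le> 2 * (r * (d + (k - r)))" by (simp only: mult.assoc)
    qed (use \<delta> in simp_all)
    also have "\<dots> = ?q ^ (r * (d + (k - r)))"
      unfolding q by (simp only: power_mult power_mult_distrib)
    finally have "ln (real m) \<le> ln (?q ^ (r * (d + (k - r))))"
      using False q1 by (intro ln_mono) auto
    also have "\<dots> = real (r * (d + (k - r))) * ln ?q" by (rule ln_realpow)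
    finally show ?thesis .
  qed
  then show "\<exists>N. ?u = enat N \<and>
      ln (real N) \<le> real r * (real d + real k - real r) * ln (36\<^sup>2 * 27 * B_x * B_w / \<epsilon>)"
    using m(1) unfolding dim by blast
qed simp

end
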